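(* Let $m\geq 1$ be an odd integer and $n>1$ an integer such that $\mathcal{A}_{m,n}:=m2^n-1$ is divisible by neither $3$ nor $5$, and such that $4m<2^n$. Let $t\in\mathbb{Z}$ be such that the Jacobi symbol $\left(\frac{t^2+1}{\mathcal{A}_{m,n}}\right)=-1$. Let $E_t$ be the elliptic curve over $\mathbb{Q}$ given by $y^2=x^3-(t^2+1)x$, and write $m\cdot(-1,t)=(\tfrac{\alpha}{\beta},\tfrac{\gamma}{\delta})\in E_t(\mathbb{Q})$ (multiplication by $m$ in the group law of $E_t$). Define the sequence \[ x_0:=\tfrac{\alpha}{\beta},\qquad x_{i+1}:=\frac{(x_i^2+t^2+1)^2}{4(x_i^3-(t^2+1)x_i)} \pmod{\mathcal{A}_{m,n}}. \] Then $\mathcal{A}_{m,n}$ is prime if and only if $x_i$ is well defined for every $0\leq i\leq n-1$ and $x_{n-1}\equiv 0\pmod{\mathcal{A}_{m,n}}$.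
   Context: The sequence is computed in the ring $\mathbb{Z}/\mathcal{A}_{m,n}\mathbb{Z}$; "$x_i$ is well defined" means that every denominator occurring in computing $x_0,\dots,x_i$ (the denominator $\beta$ of $x_0$ and the denominators $4(x_j^3-(t^2+1)x_j)$) is invertible modulo $\mathcal{A}_{m,n}$. *)

theory Defs
  imports "HOL-Number_Theory.Number_Theory"
begin

definition Jacobi :: "int \<Rightarrow> int \<Rightarrow> int" where
  "Jacobi a n = (\<Prod>p\<in>prime_factors n. Legendre a p ^ multiplicity p n)"

(* Points of y^2 = x^3 + a x over Q; None is the point at infinity. *)
type_synonym ecpt = "(rat \<times> rat) option"

(* Chord-and-tangent group law on y^2 = x^3 + a*x + b (here used with b = 0). *)
fun ec_add :: "rat \<Rightarrow> ecpt \<Rightarrow> ecpt \<Rightarrow> ecpt" where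
  "ec_add a None Q = Q"
| "ec_add a P None = P"
| "ec_add a (Some (x1, y1)) (Some (x2, y2)) =
     (if x1 = x2 \<and> y1 = - y2 then None
      else (let l = (if x1 = x2 then (3 * x1^2 + a) / (2 * y1)
                     else (y2 - y1) / (x2 - x1));
                x3 = l^2 - x1 - x2
            in Some (x3, l * (x1 - x3) - y1)))"

fun ec_mul :: "rat \<Rightarrow> nat \<Rightarrow> ecpt \<Rightarrow> ecpt" where
  "ec_mul a 0 P = None"
| "ec_mul a (Suc k) P = ec_add a P (ec_mul a k P)"

(* modular inverse of d modulo N (meaningful when coprime d N) *)
definition inv_mod :: "int \<Rightarrow> int \<Rightarrow> int" where
  "inv_mod d N = (SOME u. 0 \<le> u \<and> u < N \<and> [d * u = 1] (mod N))"

definition seq_start :: "int \<Rightarrow> nat \<Rightarrow> int \<Rightarrow> int option" where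
  "seq_start t m N =
     (case ec_mul (- (of_int (t^2 + 1))) m (Some (-1, of_int t)) of
        None \<Rightarrow> None
      | Some (x, y) \<Rightarrow>
          (let (\<alpha>, \<beta>) = quotient_of x in
           if coprime \<beta> N then Some ((\<alpha> * inv_mod \<beta> N) mod N) else None))"

definition seq_step :: "int \<Rightarrow> int \<Rightarrow> int \<Rightarrow> int option" where
  "seq_step t N x =
     (let d = 4 * (x^3 - (t^2 + 1) * x) in
      if coprime d N then Some (((x^2 + t^2 + 1)^2 * inv_mod d N) mod N) else None)"

(* x_i as an element of Z/NZ (represented in [0,N)), None = not well defined *)
fun seq_x :: "int \<Rightarrow> nat \<Rightarrow> int \<Rightarrow> nat \<Rightarrow> int option" where
  "seq_x t m N 0 = seq_start t m N"
| "seq_x t m N (Suc i) = Option.bind (seq_x t m N i) (seq_step t N)"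

end

theory Submission
  imports Defs "HOL-Algebra.Sylow" "Berlekamp_Zassenhaus.Finite_Field"
begin

text \<open>If \<open>p = m 2^n - 1\<close> is prime, then \<open>p \<equiv> 3 (mod 4)\<close>, so the curve is supersingular with \<open>p + 1 = m 2^n\<close> points
  over the field with \<open>p\<close> elements, and \<open>(0, 0)\<close> is its only point of order two because \<open>t^2 + 1\<close> is not
  a square. The point \<open>P = (-1, t)\<close> is not a double, since \<open>-1\<close> is not a square while first coordinates of
  doubles are; hence \<open>m P\<close> has order exactly \<open>2^n\<close>, and \<open>2^(n-1) m P = (0, 0)\<close>. Conversely, if the
  sequence ends in zero and \<open>q\<close> is a prime factor of \<open>A\<close>, then \<open>m P\<close> has order \<open>2^n\<close> modulo \<open>q\<close>, and the
  trivial bound \<open>2 q + 1\<close> for the number of points, together with \<open>4 m < 2^n\<close>, excludes \<open>q^2 \<le> A\<close>.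

  Associativity of the group law is obtained from the observation that three points whose sum is
  \<open>- S\<close> lie together with \<open>S\<close> on a parabola \<open>s Y = X^2 + g X + h\<close>, which is determined by the three
  points alone, irrespective of the order in which they are added.\<close>

section \<open>The group law\<close>

type_synonym 'a ell_point = "('a \<times> 'a) option"

text \<open>The formulas of \<open>ec_add\<close> over an arbitrary field, so that the curve over
  the rationals and its reductions share one theory.\<close>

fun ell_add :: "'a::field \<Rightarrow> 'a ell_point \<Rightarrow> 'a ell_point \<Rightarrow> 'a ell_point" where
  "ell_add a None Q = Q"
| "ell_add a P None = P"
| "ell_add a (Some (x1, y1)) (Some (x2, y2)) =
     (if x1 = x2 \<and> y1 = - y2 then None
      else (let l = (if x1 = x2 then (3 * x1^2 + a) / (2 * y1)
                     else (y2 - y1) / (x2 - x1));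
                x3 = l^2 - x1 - x2
            in Some (x3, l * (x1 - x3) - y1)))"

fun ell_neg :: "'a::field ell_point \<Rightarrow> 'a ell_point" where
  "ell_neg None = None"
| "ell_neg (Some (x, y)) = Some (x, - y)"

definition on_ell :: "'a::field \<Rightarrow> 'a \<times> 'a \<Rightarrow> bool" where
  "on_ell a = (\<lambda>(x, y). y^2 = x^3 + a * x)"

definition ell_points :: "'a::field \<Rightarrow> 'a ell_point set" where
  "ell_points a = insert None (Some ` {P. on_ell a P})"

text \<open>Encodes that \<open>X^3 + a X - (l X + c)^2 = (X - x1) (X - x2) (X - x3)\<close> as polynomials in \<open>X\<close>
  and that the three points lie on the line \<open>Y = l X + c\<close>; comparing coefficients takes care of
  tangency.\<close>

definition ell_line :: "'a::field \<Rightarrow> 'a \<Rightarrow> 'a \<Rightarrow> 'a \<times> 'a \<Rightarrow> 'a \<times> 'a \<Rightarrow> 'a \<times> 'a \<Rightarrow> bool" where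
  "ell_line a l c = (\<lambda>(x1, y1) (x2, y2) (x3, y3).
     x1 + x2 + x3 = l^2 \<and> x1 * x2 + x1 * x3 + x2 * x3 = a - 2 * l * c \<and> x1 * x2 * x3 = c^2 \<and>
     y1 = l * x1 + c \<and> y2 = l * x2 + c \<and> y3 = l * x3 + c)"

section \<open>Lines and their three intersection points with the curve\<close>

lemma ell_line_rotate: "ell_line a l c P Q R \<Longrightarrow> ell_line a l c Q R P"
  by (cases P, cases Q, cases R) (auto simp: ell_line_def algebra_simps)

lemma ell_line_swap: "ell_line a l c P Q R \<Longrightarrow> ell_line a l c Q P R"
  by (cases P, cases Q, cases R) (auto simp: ell_line_def algebra_simps)

lemma ell_line_reflect:
  "ell_line a l c (x1, y1) (x2, y2) (x3, y3) \<Longrightarrow> ell_line a (- l) (- c) (x1, - y1) (x2, - y2) (x3, - y3)"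
  by (auto simp: ell_line_def)

lemma ell_line_on_ell:
  assumes "ell_line a l c P Q R"
  shows "on_ell a P"
proof -
  obtain x1 y1 x2 y2 x3 y3 where [simp]: "P = (x1, y1)" "Q = (x2, y2)" "R = (x3, y3)"
    by (cases P, cases Q, cases R)
  from assms have "x1 + x2 + x3 = l^2" "x1 * x2 + x1 * x3 + x2 * x3 = a - 2 * l * c"
    "x1 * x2 * x3 = c^2" and y1: "y1 = l * x1 + c"
    by (auto simp: ell_line_def)
  then have "(l * x1 + c)^2 = x1^3 + a * x1" by Groebner_Basis.algebra
  then show ?thesis by (simp add: on_ell_def y1)
qed

text \<open>A repeated abscissa \<open>x\<close> is a double root of
  \<open>X^3 + a X - (l X + c)^2\<close>, so the derivative \<open>3 x^2 + a - 2 l (l x + c)\<close>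
  vanishes there.\<close>

lemma ell_line_tangent:
  assumes "ell_line a l c (x, y) (x, y') R"
  shows "y' = y" "2 * l * y = 3 * x^2 + a"
proof -
  obtain x3 y3 where [simp]: "R = (x3, y3)" by (cases R)
  from assms have *: "x + x + x3 = l^2" "x * x + x * x3 + x * x3 = a - 2 * l * c"
    and y: "y = l * x + c" "y' = l * x + c"
    by (auto simp: ell_line_def mult_ac)
  then show "y' = y" by simp
  from * have "2 * l * (l * x + c) = 3 * x^2 + a" by Groebner_Basis.algebra
  with y show "2 * l * y = 3 * x^2 + a" by simp
qed

text \<open>At the root \<open>0\<close> of \<open>X^3 + a X\<close> the derivative is
  \<open>a\<close>, and at a root with \<open>x^2 = - a\<close> it is \<open>- 2 a\<close>.\<close>

lemma ell_nonsingular: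
  fixes x y :: "'a::field"
  assumes "a \<noteq> 0" "(2::'a) \<noteq> 0" "y^2 = x^3 + a * x" "y = 0"
  shows "3 * x^2 + a \<noteq> 0"
proof
  assume *: "3 * x^2 + a = 0"
  from assms have "x * (x^2 + a) = 0" by (simp add: algebra_simps power2_eq_square power3_eq_cube)
  then consider "x = 0" | "x^2 + a = 0" by auto
  then show False
  proof cases
    case 1
    with * assms show False by simp
  next
    case 2
    then have "2 * a = 3 * (x^2 + a) - (3 * x^2 + a)" by Groebner_Basis.algebra
    with 2 * have "2 * a = 0" by simp
    with assms show False by simp
  qed
qed

text \<open>Opposite points are joined by a vertical line or, where \<open>y = 0\<close>, have a
  vertical tangent; neither has an equation \<open>Y = l X + c\<close>. The tangent case is where
  nonsingularity enters.\<close>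

lemma ell_line_not_opposite:
  fixes x1 :: "'a::field"
  assumes "a \<noteq> 0" "(2::'a) \<noteq> 0" "ell_line a l c (x1, y1) (x2, y2) R"
  shows "\<not> (x1 = x2 \<and> y1 = - y2)"
proof
  assume *: "x1 = x2 \<and> y1 = - y2"
  with assms(3) have **: "y2 = y1" "2 * l * y1 = 3 * x1^2 + a"
    using ell_line_tangent[of a l c x1 y1 y2 R] by auto
  with * have "2 * y1 = 0" by simp
  with assms(2) have "y1 = 0" by simp
  moreover have "on_ell a (x1, y1)" using assms(3) by (rule ell_line_on_ell)
  ultimately have "3 * x1^2 + a \<noteq> 0"
    using ell_nonsingular[OF assms(1,2)] by (simp add: on_ell_def)
  with ** \<open>y1 = 0\<close> show False by simp
qed

text \<open>Removes the distinction between chord and tangent, so that the group axioms can be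
  derived from the symmetries of \<open>ell_line\<close>.\<close>

lemma ell_add_line:
  fixes x1 :: "'a::field"
  assumes "a \<noteq> 0" "(2::'a) \<noteq> 0" "ell_line a l c (x1, y1) (x2, y2) (x3, y3)"
  shows "ell_add a (Some (x1, y1)) (Some (x2, y2)) = Some (x3, - y3)"
proof -
  note * = ell_line_not_opposite[OF assms]
  have l: "l = (if x1 = x2 then (3 * x1^2 + a) / (2 * y1) else (y2 - y1) / (x2 - x1))"
  proof (cases "x1 = x2")
    case True
    have **: "y2 = y1" "2 * l * y1 = 3 * x1^2 + a"
      using ell_line_tangent[of a l c x1 y1 y2 "(x3, y3)"] assms(3) True by auto
    with * True have "y1 \<noteq> 0" by auto
    with ** True assms(2) show ?thesis by (simp add: field_simps)
  next
    case False
    from assms(3) have "y2 - y1 = l * (x2 - x1)" by (auto simp: ell_line_def algebra_simps)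
    with False show ?thesis by (simp add: field_simps)
  qed
  have x3: "x3 = l^2 - x1 - x2" using assms(3) by (auto simp: ell_line_def algebra_simps)
  have y3: "- y3 = l * (x1 - x3) - y1" using assms(3) by (auto simp: ell_line_def algebra_simps)
  show ?thesis using * l x3 y3 by (simp add: Let_def)
qed

lemma ell_line_exists:
  fixes x1 :: "'a::field"
  assumes "(2::'a) \<noteq> 0" "on_ell a (x1, y1)" "on_ell a (x2, y2)" "\<not> (x1 = x2 \<and> y1 = - y2)"
  obtains l c x3 y3 where "ell_line a l c (x1, y1) (x2, y2) (x3, y3)"
proof (cases "x1 = x2")
  case True
  have y: "y1^2 = x1^3 + a * x1" "y2^2 = x2^3 + a * x2" using assms by (auto simp: on_ell_def)
  then have "(y1 - y2) * (y1 + y2) = 0" unfolding True by Groebner_Basis.algebra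
  with True assms(4) have y2: "y2 = y1" by (auto simp: eq_neg_iff_add_eq_0)
  with True assms(4) have "y1 \<noteq> 0" by auto
  define l where "l = (3 * x1^2 + a) / (2 * y1)"
  have l: "2 * l * y1 = 3 * x1^2 + a" using \<open>y1 \<noteq> 0\<close> assms(1) by (simp add: l_def)
  have "x1 * x1 * (l^2 - 2 * x1) = (y1 - l * x1)^2"
    using l y by Groebner_Basis.algebra
  moreover have "x1 * x1 + x1 * (l^2 - 2 * x1) + x1 * (l^2 - 2 * x1) = a - 2 * l * (y1 - l * x1)"
    using l by Groebner_Basis.algebra
  ultimately have "ell_line a l (y1 - l * x1) (x1, y1) (x2, y2)
      (l^2 - 2 * x1, l * (l^2 - 2 * x1) + (y1 - l * x1))"
    using True y2 by (simp add: ell_line_def mult_ac)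
  then show ?thesis by (rule that)
next
  case False
  have y: "y1^2 = x1^3 + a * x1" "y2^2 = x2^3 + a * x2" using assms by (auto simp: on_ell_def)
  define l where "l = (y2 - y1) / (x2 - x1)"
  define c where "c = y1 - l * x1"
  have l: "l * (x2 - x1) = y2 - y1" using False by (simp add: l_def)
  have y1: "y1 = l * x1 + c" by (simp add: c_def)
  have y2: "y2 = l * x2 + c" using l by (simp add: c_def algebra_simps)
  \<comment> \<open>The difference of the two curve equations is divisible by
    \<open>x2 - x1\<close>; cancelling this factor gives the middle coefficient.\<close>
  have "(x2 - x1) * (x1 * x2 + x1 * (l^2 - x1 - x2) + x2 * (l^2 - x1 - x2) - (a - 2 * l * c)) = 0"
    using y unfolding y1 y2 by Groebner_Basis.algebra
  with False have e: "x1 * x2 + x1 * (l^2 - x1 - x2) + x2 * (l^2 - x1 - x2) = a - 2 * l * c" by simp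
  then have "x1 * x2 * (l^2 - x1 - x2) = c^2" using y unfolding y1 y2 by Groebner_Basis.algebra
  with e have "ell_line a l c (x1, y1) (x2, y2) (l^2 - x1 - x2, l * (l^2 - x1 - x2) + c)"
    using y1 y2 by (simp add: ell_line_def)
  then show ?thesis by (rule that)
qed

text \<open>Encodes that \<open>(X^2 + g X + h)^2 - s^2 (X^3 + a X)\<close> has the roots \<open>x1\<close>, \<open>x2\<close>, \<open>x3\<close>, \<open>x4\<close> and that the
  points lie on the parabola \<open>s Y = X^2 + g X + h\<close>, i.e. that this parabola meets the curve exactly in
  the four points, which therefore add up to zero.\<close>

definition ell_quartic ::
    "'a::field \<Rightarrow> 'a \<Rightarrow> 'a \<Rightarrow> 'a \<Rightarrow> 'a \<times> 'a \<Rightarrow> 'a \<times> 'a \<Rightarrow> 'a \<times> 'a \<Rightarrow> 'a \<times> 'a \<Rightarrow> bool" where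
  "ell_quartic a s g h = (\<lambda>(x1, y1) (x2, y2) (x3, y3) (x4, y4). s \<noteq> 0 \<and>
     x1 + x2 + x3 + x4 = s^2 - 2 * g \<and>
     x1 * x2 + x1 * x3 + x1 * x4 + x2 * x3 + x2 * x4 + x3 * x4 = g^2 + 2 * h \<and>
     x1 * x2 * x3 + x1 * x2 * x4 + x1 * x3 * x4 + x2 * x3 * x4 = s^2 * a - 2 * g * h \<and>
     x1^2 + g * x1 + h = s * y1 \<and> x2^2 + g * x2 + h = s * y2 \<and>
     x3^2 + g * x3 + h = s * y3 \<and> x4^2 + g * x4 + h = s * y4)"

section \<open>Parabolas and their four intersection points with the curve\<close>

lemma ell_quartic_rotate: "ell_quartic a s g h P Q R S \<Longrightarrow> ell_quartic a s g h R P Q S"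
  by (cases P, cases Q, cases R, cases S) (auto simp: ell_quartic_def algebra_simps)

text \<open>At a double root the derivative \<open>2 s y (2 x + g) - s^2 (3 x^2 + a)\<close> of the
  quartic vanishes, and \<open>s\<close> can be cancelled.\<close>

lemma ell_quartic_tangent:
  assumes "ell_quartic a s g h (x, y) (x, y) R S"
  shows "2 * y * (2 * x + g) = s * (3 * x^2 + a)"
proof -
  obtain x3 y3 x4 y4 where [simp]: "R = (x3, y3)" "S = (x4, y4)" by (cases R, cases S)
  from assms have s: "s \<noteq> 0" and *: "x + x + x3 + x4 = s^2 - 2 * g"
     "x * x + x * x3 + x * x4 + x * x3 + x * x4 + x3 * x4 = g^2 + 2 * h"
     "x * x * x3 + x * x * x4 + x * x3 * x4 + x * x3 * x4 = s^2 * a - 2 * g * h"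
     "x^2 + g * x + h = s * y"
    by (simp_all add: ell_quartic_def mult_ac)
  from * have "s * (2 * y * (2 * x + g) - s * (3 * x^2 + a)) = 0" by Groebner_Basis.algebra
  with s show ?thesis by simp
qed

lemma quadratic_zero:
  fixes x1 :: "'a::field"
  assumes "x1 \<noteq> x2" "x1 \<noteq> x3" "x2 \<noteq> x3"
    and "p * x1^2 + q * x1 + r = 0" "p * x2^2 + q * x2 + r = 0" "p * x3^2 + q * x3 + r = 0"
  shows "p = 0 \<and> q = 0 \<and> r = 0"
proof -
  have "(x1 - x2) * (p * (x1 + x2) + q) = 0" "(x1 - x3) * (p * (x1 + x3) + q) = 0"
    using assms(4-) by Groebner_Basis.algebra+
  with assms(1,2) have *: "p * (x1 + x2) + q = 0" "p * (x1 + x3) + q = 0" by simp_all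
  then have "(x2 - x3) * p = 0" by Groebner_Basis.algebra
  with assms(3) have "p = 0" by simp
  with * assms(4) show ?thesis by simp
qed

lemma quadratic_zero_double:
  fixes x1 :: "'a::field"
  assumes "x1 \<noteq> x2" "p * x1^2 + q * x1 + r = 0" "p * x2^2 + q * x2 + r = 0" "2 * p * x1 + q = 0"
  shows "p = 0 \<and> q = 0 \<and> r = 0"
proof -
  have "(x1 - x2)^2 * p = 0" using assms(2-) by Groebner_Basis.algebra
  with assms(1) have "p = 0" by simp
  with assms(2,4) show ?thesis by simp
qed

text \<open>Eliminating \<open>y\<close> from the two parabolas leaves a polynomial of degree at
  most two with three roots. If two abscissae coincide, \<open>opp\<close> makes the points equal
  with \<open>y\<close> nonzero, and tangency supplies the missing root. So the parabolas agree, and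
  the sum of the roots fixes the fourth point.\<close>

lemma ell_quartic_unique:
  fixes x1 :: "'a::field"
  assumes two: "(2::'a) \<noteq> 0"
    and Q: "ell_quartic a s g h (x1, y1) (x2, y2) (x3, y3) S"
    and Q': "ell_quartic a s' g' h' (x1, y1) (x2, y2) (x3, y3) S'"
    and ne: "(x1, y1) \<noteq> (x3, y3)"
    and opp: "x1 = x2 \<Longrightarrow> y1 = y2 \<and> y1 \<noteq> 0" "x2 = x3 \<Longrightarrow> y2 = y3 \<and> y2 \<noteq> 0" "x1 = x3 \<Longrightarrow> y1 = y3"
  shows "S = S'"
proof -
  obtain x4 y4 x4' y4' where [simp]: "S = (x4, y4)" "S' = (x4', y4')" by (cases S, cases S')
  \<comment> \<open>Coefficients of \<open>s' (X^2 + g X + h) - s (X^2 + g' X + h')\<close>.\<close>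
  define p q r where "p = s' - s" "q = s' * g - s * g'" "r = s' * h - s * h'"
  have x13: "x1 \<noteq> x3" using ne opp(3) by auto
  have z: "x^2 + g * x + h = s * y \<Longrightarrow> x^2 + g' * x + h' = s' * y \<Longrightarrow> p * x^2 + q * x + r = 0" for x y
    unfolding p_q_r_def by Groebner_Basis.algebra
  have z1: "p * x1^2 + q * x1 + r = 0" and z2: "p * x2^2 + q * x2 + r = 0"
    and z3: "p * x3^2 + q * x3 + r = 0"
    using Q Q' by (auto intro: z simp: ell_quartic_def)
  have tangent: "2 * p * x + q = 0"
    if "2 * y * (2 * x + g) = s * (3 * x^2 + a)" "2 * y * (2 * x + g') = s' * (3 * x^2 + a)" "y \<noteq> 0" for x y
  proof -
    have "(2 * y) * (2 * p * x + q) = 0" unfolding p_q_r_def using that(1,2) by Groebner_Basis.algebra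
    with that(3) two show ?thesis by simp
  qed
  have "p = 0 \<and> q = 0 \<and> r = 0"
  proof (cases "x1 = x2")
    case True
    with opp(1) have e: "(x2, y2) = (x1, y1)" "y1 \<noteq> 0" by auto
    have "2 * p * x1 + q = 0"
      using tangent[OF ell_quartic_tangent ell_quartic_tangent e(2)] Q Q' unfolding e(1) by blast
    with x13 z1 z3 show ?thesis by (intro quadratic_zero_double[of x1 x3])
  next
    case x12: False
    show ?thesis
    proof (cases "x2 = x3")
      case True
      with opp(2) have e: "(x2, y2) = (x3, y3)" "y3 \<noteq> 0" by auto
      have "2 * p * x3 + q = 0"
        using tangent[OF ell_quartic_tangent ell_quartic_tangent e(2)]
          ell_quartic_rotate[OF ell_quartic_rotate[OF Q]] ell_quartic_rotate[OF ell_quartic_rotate[OF Q']]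
        unfolding e(1) by blast
      with x13 z1 z3 show ?thesis by (intro quadratic_zero_double[of x3 x1]) auto
    next
      case False
      with x12 x13 z1 z2 z3 show ?thesis by (intro quadratic_zero)
    qed
  qed
  then have "s' = s" "s * (g - g') = 0" "s * (h - h') = 0"
    by (auto simp: p_q_r_def algebra_simps)
  with Q have [simp]: "s' = s" "g' = g" "h' = h" and s: "s \<noteq> 0" by (auto simp: ell_quartic_def)
  have "x4 = s^2 - 2 * g - x1 - x2 - x3" using Q by (auto simp: ell_quartic_def algebra_simps)
  moreover have "x4' = s^2 - 2 * g - x1 - x2 - x3" using Q' by (auto simp: ell_quartic_def algebra_simps)
  ultimately have x4: "x4' = x4" by simp
  have "s * y4' = s * y4" using Q Q' x4 by (auto simp: ell_quartic_def)
  with s x4 show ?thesis by simp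
qed

text \<open>The product of the equations of the two lines is divisible by \<open>X - xq\<close> modulo the equation of
  the curve, and the quotient is the parabola.\<close>

lemma ell_quartic_of_lines:
  assumes L: "ell_line a l c (x1, y1) (x2, y2) (xq, - yq)"
    and M: "ell_line a l' c' (xq, yq) (x3, y3) (x4, y4)" and s: "l + l' \<noteq> 0"
  shows "ell_quartic a (l + l') (l * l' + xq) ((l + l') * c + x1 * x2)
           (x1, y1) (x2, y2) (x3, y3) (x4, y4)"
proof -
  have 1: "x1 + x2 = l^2 - xq" "x1 * x2 + xq * (x1 + x2) = a - 2 * l * c" "x1 * x2 * xq = c^2"
    "xq + x3 + x4 = l'^2" "x3 * x4 + xq * (x3 + x4) = a - 2 * l' * c'" "xq * x3 * x4 = c'^2"
    and y: "y1 = l * x1 + c" "y2 = l * x2 + c" "- yq = l * xq + c"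
    "y3 = l' * x3 + c'" "y4 = l' * x4 + c'" "yq = l' * xq + c'"
    using L M by (auto simp: ell_line_def algebra_simps)
  define s where "s = l + l'"
  define g where "g = l * l' + xq"
  define h where "h = s * c + x1 * x2"
  \<comment> \<open>By this relation \<open>Y\<close> occurs in the product of the line equations
    only as \<open>Y^2\<close> and in a multiple of \<open>Y (X - xq)\<close>, which makes the
    division by \<open>X - xq\<close> possible.\<close>
  have c: "c + c' = - s * xq" using y(3,6) unfolding s_def by Groebner_Basis.algebra
  \<comment> \<open>Vieta: \<open>x1\<close> and \<open>x2\<close> are the roots of
    \<open>X^2 + g X + h - s (l X + c)\<close>, and \<open>x3\<close> and \<open>x4\<close> those of
    \<open>X^2 + g X + h - s (l' X + c')\<close>.\<close>
  have A: "x1 + x2 = s * l - g" "x1 * x2 = h - s * c"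
    using 1(1) unfolding s_def g_def h_def by (Groebner_Basis.algebra, simp)
  have B: "x3 + x4 = s * l' - g" using 1(4) unfolding s_def g_def by Groebner_Basis.algebra
  have C: "x3 * x4 = h - s * c'" using 1 c unfolding s_def g_def h_def by Groebner_Basis.algebra
  have a: "a = h - s * c + xq * (s * l - g) + 2 * l * c" using 1(2) unfolding A by Groebner_Basis.algebra
  have e1: "x1 + x2 + x3 + x4 = s^2 - 2 * g"
    using A(1) B unfolding s_def by Groebner_Basis.algebra
  have "x1 * x2 + x1 * x3 + x1 * x4 + x2 * x3 + x2 * x4 + x3 * x4 =
      x1 * x2 + x3 * x4 + (x1 + x2) * (x3 + x4)" by Groebner_Basis.algebra
  also have "\<dots> = g^2 + 2 * h" unfolding A B C using c unfolding s_def g_def by Groebner_Basis.algebra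
  finally have e2: "x1 * x2 + x1 * x3 + x1 * x4 + x2 * x3 + x2 * x4 + x3 * x4 = g^2 + 2 * h" .
  have "x1 * x2 * x3 + x1 * x2 * x4 + x1 * x3 * x4 + x2 * x3 * x4 =
      x1 * x2 * (x3 + x4) + x3 * x4 * (x1 + x2)" by Groebner_Basis.algebra
  also have "\<dots> = s^2 * a - 2 * g * h"
    unfolding A B C a using c 1(3) unfolding A unfolding s_def g_def by Groebner_Basis.algebra
  finally have e3: "x1 * x2 * x3 + x1 * x2 * x4 + x1 * x3 * x4 + x2 * x3 * x4 = s^2 * a - 2 * g * h" .
  have "x1^2 + g * x1 + h = s * y1" "x2^2 + g * x2 + h = s * y2"
    unfolding y using A by Groebner_Basis.algebra+
  moreover have "x3^2 + g * x3 + h = s * y3" "x4^2 + g * x4 + h = s * y4"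
    unfolding y using B C by Groebner_Basis.algebra+
  ultimately show ?thesis using e1 e2 e3 s
    unfolding ell_quartic_def s_def[symmetric] g_def[symmetric] h_def[symmetric] by simp
qed

text \<open>The case without a parabola: opposite slopes make the second line the mirror image of
  the first, so its intersection points are the negatives of those of the first.\<close>

lemma ell_lines_opposite:
  fixes x1 :: "'a::field"
  assumes L: "ell_line a l c (x1, y1) (x2, y2) (xq, - yq)"
    and M: "ell_line a l' c' (xq, yq) (x3, y3) (x4, y4)" and s: "l + l' = 0"
  shows "x3 = x1 \<and> y3 = - y1 \<or> x3 = x2 \<and> y3 = - y2"
proof -
  have l': "l' = - l" using s by (simp add: eq_neg_iff_add_eq_0 add.commute)
  have "- yq = l * xq + c" "yq = l' * xq + c'" using L M by (auto simp: ell_line_def)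
  then have c': "c' = - c" unfolding l' by Groebner_Basis.algebra
  have "x1 + x2 + xq = l^2" "x1 * x2 + xq * (x1 + x2) = a - 2 * l * c"
    "xq + x3 + x4 = l^2" "x3 * x4 + xq * (x3 + x4) = a - 2 * l * c"
    using L M l' c' by (auto simp: ell_line_def algebra_simps)
  then have "(x3 - x1) * (x3 - x2) = 0" by Groebner_Basis.algebra
  moreover have "y1 = l * x1 + c" "y2 = l * x2 + c" "y3 = - (l * x3 + c)"
    using L M l' c' by (auto simp: ell_line_def)
  ultimately show ?thesis by auto
qed

section \<open>The group axioms\<close>

lemma ell_add_comm:
  assumes "(2::'a::field) \<noteq> 0" "a \<noteq> 0" "P \<in> ell_points (a :: 'a)" "Q \<in> ell_points a"
  shows "ell_add a P Q = ell_add a Q P"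
proof (cases "P = None \<or> Q = None")
  case True
  then show ?thesis by (cases P; cases Q) auto
next
  case False
  then obtain x1 y1 x2 y2 where [simp]: "P = Some (x1, y1)" "Q = Some (x2, y2)" by auto
  have on: "on_ell a (x1, y1)" "on_ell a (x2, y2)" using assms by (auto simp: ell_points_def)
  show ?thesis
  proof (cases "x1 = x2 \<and> y1 = - y2")
    case False
    from ell_line_exists[OF assms(1) on False]
    obtain l c x3 y3 where L: "ell_line a l c (x1, y1) (x2, y2) (x3, y3)" .
    show ?thesis
      using ell_add_line[OF assms(2,1) L] ell_add_line[OF assms(2,1) ell_line_swap[OF L]] by simp
  qed simp
qed

lemma ell_neg_closed: "P \<in> ell_points a \<Longrightarrow> ell_neg P \<in> ell_points a"
  by (auto simp: ell_points_def on_ell_def)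

lemma ell_neg_neg [simp]: "ell_neg (ell_neg P) = P"
  by (cases P) auto

lemma ell_add_neg [simp]: "ell_add a P (ell_neg P) = None"
  by (cases P) auto

lemma ell_add_cases:
  fixes a :: "'a::field"
  assumes "(2::'a) \<noteq> 0" "a \<noteq> 0" "P \<in> ell_points a" "Q \<in> ell_points a"
  obtains "P = None" | "Q = None" | "P = ell_neg Q"
  | l c x1 y1 x2 y2 x3 y3 where "P = Some (x1, y1)" "Q = Some (x2, y2)"
      "ell_line a l c (x1, y1) (x2, y2) (x3, - y3)" "ell_add a P Q = Some (x3, y3)"
proof (cases "P = None \<or> Q = None \<or> P = ell_neg Q")
  case False
  then obtain x1 y1 x2 y2 where PQ: "P = Some (x1, y1)" "Q = Some (x2, y2)" by auto
  have on: "on_ell a (x1, y1)" "on_ell a (x2, y2)" using assms PQ by (auto simp: ell_points_def)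
  from False PQ have "\<not> (x1 = x2 \<and> y1 = - y2)" by auto
  from ell_line_exists[OF assms(1) on this]
  obtain l c x3 y3 where "ell_line a l c (x1, y1) (x2, y2) (x3, y3)" .
  with that(4)[OF PQ, of l c x3 "- y3"] PQ ell_add_line[OF assms(2,1)] show ?thesis by auto
qed (use that in auto)

lemma ell_add_closed:
  assumes "(2::'a::field) \<noteq> 0" "a \<noteq> 0" "P \<in> ell_points (a :: 'a)" "Q \<in> ell_points a"
  shows "ell_add a P Q \<in> ell_points a"
  using assms
proof (cases rule: ell_add_cases)
  case (4 l c x1 y1 x2 y2 x3 y3)
  then have "on_ell a (x3, - y3)" using ell_line_on_ell[OF ell_line_rotate[OF ell_line_rotate]] by metis
  with 4 show ?thesis by (auto simp: ell_points_def on_ell_def)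
next
  case 2
  with assms show ?thesis by (cases P) auto
next
  case 3
  then show ?thesis using ell_add_neg[of a P] by (simp add: ell_points_def)
qed (use assms in auto)

text \<open>The line through \<open>P\<close>, \<open>Q\<close> and \<open>- (P + Q)\<close>
  reflects to a line through \<open>P + Q\<close>, \<open>- Q\<close> and \<open>- P\<close>. This
  instance of associativity settles degenerate cases of the general law.\<close>

lemma ell_add_neg_cancel:
  assumes "(2::'a::field) \<noteq> 0" "a \<noteq> 0" "P \<in> ell_points (a :: 'a)" "Q \<in> ell_points a"
  shows "ell_add a (ell_add a P Q) (ell_neg Q) = P"
  using assms
proof (cases rule: ell_add_cases)
  case (4 l c x1 y1 x2 y2 x3 y3)
  have "ell_line a (- l) (- c) (x3, y3) (x2, - y2) (x1, - y1)"
    using ell_line_reflect[OF ell_line_rotate[OF ell_line_rotate[OF ell_line_swap[OF 4(3)]]]]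
      ell_line_rotate ell_line_swap by fastforce
  from ell_add_line[OF assms(2,1) this] 4 show ?thesis by simp
next
  case 2
  then show ?thesis by (cases P) auto
next
  case 3
  then have "ell_add a P Q = None" using ell_add_neg[of a P] by simp
  with 3 show ?thesis by simp
qed auto

declare ell_add.simps(3) [simp del]

lemma ell_add_assoc:
  fixes a :: "'a::field"
  assumes "(2::'a) \<noteq> 0" "a \<noteq> 0"
    and P: "P \<in> ell_points a" and Q: "Q \<in> ell_points a" and R: "R \<in> ell_points a"
  shows "ell_add a (ell_add a P Q) R = ell_add a P (ell_add a Q R)"
proof -
  note comm = ell_add_comm[OF assms(1,2)] and cancel = ell_add_neg_cancel[OF assms(1,2)]
    and closed = ell_add_closed[OF assms(1,2)]
  have none: "ell_add a X None = X" for X by (cases X) auto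
  consider "P = None \<or> Q = None \<or> R = None" | "P = R" | "R = ell_neg Q" | "P = ell_neg Q" | "R = ell_neg P"
    | "P \<noteq> None" "Q \<noteq> None" "R \<noteq> None" "P \<noteq> R" "R \<noteq> ell_neg Q" "P \<noteq> ell_neg Q" "R \<noteq> ell_neg P"
    by blast
  then show ?thesis
  proof cases
    case 1
    then show ?thesis by (auto simp: none)
  next
    case 2
    then show ?thesis using P Q R comm closed by metis
  next
    case 3
    then show ?thesis using cancel[OF P Q] by (simp add: none)
  next
    case 4
    then show ?thesis using cancel[OF R Q] P Q R comm closed ell_add_neg ell_neg_neg
      by (metis ell_add.simps(1))
  next
    case 5
    then show ?thesis using cancel[OF Q P] cancel[OF Q R] P Q R comm closed ell_neg_neg by metis
  next
    case 6
    from 6 obtain l c x1 y1 x2 y2 xq yq where PQ: "P = Some (x1, y1)" "Q = Some (x2, y2)"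
      "ell_line a l c (x1, y1) (x2, y2) (xq, - yq)" "ell_add a P Q = Some (xq, yq)"
      by - (rule ell_add_cases[OF assms(1,2) P Q], auto)
    have RQ: "R \<noteq> ell_neg Q" "Q \<noteq> ell_neg R" using 6 by auto
    with 6 obtain m d x2' y2' x3 y3 xr yr where QR: "Q = Some (x2', y2')" "R = Some (x3, y3)"
      "ell_line a m d (x2', y2') (x3, y3) (xr, - yr)" "ell_add a Q R = Some (xr, yr)"
      by - (rule ell_add_cases[OF assms(1,2) Q R], auto)
    from PQ QR have [simp]: "x2' = x2" "y2' = y2" by auto
    \<comment> \<open>If \<open>P\<close>, \<open>Q\<close>, \<open>R\<close> are collinear, both
      bracketings give infinity; otherwise the second additions have lines as well.\<close>
    consider "R = Some (xq, - yq)" | "P = Some (xr, - yr)"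
      | "Some (xq, yq) \<noteq> ell_neg R" "Some (xr, yr) \<noteq> ell_neg P"
      by (metis ell_neg.simps(2) ell_neg_neg)
    then show ?thesis
    proof cases
      case 1
      with QR have "ell_line a l c (x2, y2) (x3, y3) (x1, y1)"
        using ell_line_rotate[OF PQ(3)] by simp
      from ell_add_line[OF assms(2,1) this] PQ QR have "ell_add a Q R = ell_neg P" by simp
      moreover have "R = ell_neg (ell_add a P Q)" using 1 PQ by simp
      ultimately show ?thesis by (metis ell_add_neg)
    next
      case 2
      with PQ have "ell_line a m d (x1, y1) (x2, y2) (x3, y3)"
        using ell_line_rotate[OF ell_line_rotate[OF QR(3)]] by simp
      from ell_add_line[OF assms(2,1) this] PQ QR have "ell_add a P Q = ell_neg R" by simp
      moreover have "P = ell_neg (ell_add a Q R)" using 2 QR by simp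
      ultimately show ?thesis by (metis ell_add_neg ell_neg_neg)
    next
      case 3
      have "Some (xq, yq) \<in> ell_points a" "Some (xr, yr) \<in> ell_points a"
        using closed P Q R PQ(4) QR(4) by metis+
      obtain l' c' x4 y4 where S: "ell_line a l' c' (xq, yq) (x3, y3) (x4, - y4)"
        "ell_add a (Some (xq, yq)) R = Some (x4, y4)"
        using 3(1) QR(2) by - (rule ell_add_cases[OF assms(1,2) \<open>Some (xq, yq) \<in> ell_points a\<close> R], auto)
      obtain m' d' x5 y5 where S': "ell_line a m' d' (xr, yr) (x1, y1) (x5, - y5)"
        "ell_add a (Some (xr, yr)) P = Some (x5, y5)"
        using 3(2) PQ(1) by - (rule ell_add_cases[OF assms(1,2) \<open>Some (xr, yr) \<in> ell_points a\<close> P], auto)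
      \<comment> \<open>Opposite slopes would make \<open>R\<close> the negative of \<open>P\<close>
        or of \<open>Q\<close>, which this case excludes.\<close>
      have "l + l' \<noteq> 0" using ell_lines_opposite[OF PQ(3) S(1)] 6 PQ(1,2) QR(2) by auto
      from ell_quartic_of_lines[OF PQ(3) S(1) this]
      obtain s g h where q: "ell_quartic a s g h (x1, y1) (x2, y2) (x3, y3) (x4, - y4)" by blast
      have "m + m' \<noteq> 0" using ell_lines_opposite[OF QR(3) S'(1)] 6 PQ(1,2) QR(2) by auto
      from ell_quartic_of_lines[OF QR(3) S'(1) this]
      obtain s' g' h' where "ell_quartic a s' g' h' (x2, y2) (x3, y3) (x1, y1) (x5, - y5)" by auto
      then have q': "ell_quartic a s' g' h' (x1, y1) (x2, y2) (x3, y3) (x5, - y5)"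
        by (rule ell_quartic_rotate)
      \<comment> \<open>Equal abscissae leave only equal or opposite points, and excluding opposite
        ones also excludes \<open>y = 0\<close>.\<close>
      have sq: "y = y' \<and> y \<noteq> 0" if "on_ell a (x, y)" "on_ell a (x, y')" "y \<noteq> - y'" for x y y'
      proof -
        from that have "(y - y') * (y + y') = 0" by (auto simp: on_ell_def algebra_simps power2_eq_square)
        with that(3) have "y = y'" by (auto simp: eq_neg_iff_add_eq_0)
        with that(3) show ?thesis by auto
      qed
      have on: "on_ell a (x1, y1)" "on_ell a (x2, y2)" "on_ell a (x3, y3)"
        using P Q R PQ QR by (auto simp: ell_points_def)
      have "(x4, - y4) = (x5, - y5)"
        using assms(1) q q'
      proof (rule ell_quartic_unique)
        show "(x1, y1) \<noteq> (x3, y3)" using 6 PQ QR by auto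
        show "x1 = x2 \<Longrightarrow> y1 = y2 \<and> y1 \<noteq> 0" using sq[OF on(1), of y2] on 6 PQ by auto
        show "x2 = x3 \<Longrightarrow> y2 = y3 \<and> y2 \<noteq> 0" using sq[OF on(2), of y3] on RQ PQ QR by auto
        have "x1 = x3 \<Longrightarrow> y1 \<noteq> - y3"
          using 6(7) PQ(1) QR(2) minus_equation_iff[of y3 y1] by auto
        then show "x1 = x3 \<Longrightarrow> y1 = y3" using sq[OF on(1), of y3] on(3) by auto
      qed
      then have "ell_add a (ell_add a P Q) R = ell_add a (ell_add a Q R) P"
        using PQ QR S S' by simp
      also have "\<dots> = ell_add a P (ell_add a Q R)" using P Q R closed comm by blast
      finally show ?thesis .
    qed
  qed
qed

definition ell_group :: "'a::field \<Rightarrow> ('a ell_point) monoid" where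
  "ell_group a = \<lparr>carrier = ell_points a, mult = ell_add a, one = None\<rparr>"

lemma ell_comm_group:
  assumes "(2::'a::field) \<noteq> 0" "(a :: 'a) \<noteq> 0"
  shows "comm_group (ell_group a)"
proof (rule comm_groupI)
  fix P assume P: "P \<in> carrier (ell_group a)"
  then show "\<exists>Q\<in>carrier (ell_group a). Q \<otimes>\<^bsub>ell_group a\<^esub> P = \<one>\<^bsub>ell_group a\<^esub>"
    using ell_neg_closed[of P a] ell_add_neg[of a "ell_neg P"]
    by (intro bexI[of _ "ell_neg P"]) (auto simp: ell_group_def)
qed (use ell_add_assoc[OF assms] ell_add_comm[OF assms] ell_add_closed[OF assms] in
    \<open>auto simp: ell_group_def ell_points_def\<close>)

section \<open>Abelian groups with few involutions\<close>

lemma card_le_fibres: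
  assumes "finite A" "\<And>b. b \<in> f ` A \<Longrightarrow> card {a \<in> A. f a = b} \<le> c"
  shows "card A \<le> c * card (f ` A)"
proof -
  have "A = (\<Union>b\<in>f ` A. {a \<in> A. f a = b})" by auto
  then have "card A \<le> (\<Sum>b\<in>f ` A. card {a \<in> A. f a = b})"
    using card_UN_le[of "f ` A" "\<lambda>b. {a \<in> A. f a = b}"] assms(1) by simp
  also have "\<dots> \<le> c * card (f ` A)"
    using sum_bounded_above[of "f ` A" "\<lambda>b. card {a \<in> A. f a = b}" c] assms(2) by (simp add: mult.commute)
  finally show ?thesis .
qed

context comm_group
begin

text \<open>A nonempty fibre of a power map is a translate of its kernel.\<close>

lemma card_pow_fibre_le:
  fixes k :: nat
  assumes "finite (carrier G)"
  shows "card {a \<in> carrier G. a [^] k = b} \<le> card {a \<in> carrier G. a [^] k = \<one>}"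
proof (cases "\<exists>a\<in>carrier G. a [^] k = b")
  case True
  then obtain a where a: "a \<in> carrier G" "a [^] k = b" by blast
  show ?thesis
  proof (rule card_inj_on_le[where f = "\<lambda>x. x \<otimes> inv a"])
    show "inj_on (\<lambda>x. x \<otimes> inv a) {a \<in> carrier G. a [^] k = b}"
      using a by (auto intro!: inj_onI)
    show "(\<lambda>x. x \<otimes> inv a) ` {a \<in> carrier G. a [^] k = b} \<subseteq> {a \<in> carrier G. a [^] k = \<one>}"
      using a by (auto simp: nat_pow_distrib nat_pow_inv)
  qed (use assms in auto)
next
  case False
  then have e: "{a \<in> carrier G. a [^] k = b} = {}" by auto
  show ?thesis unfolding e by simp
qed

text \<open>Squaring maps the elements killed by \<open>2 ^ Suc j\<close> to those killed by
  \<open>2 ^ j\<close>, with fibres of at most two elements.\<close>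

lemma card_pow_kernel_two_power:
  assumes fin: "finite (carrier G)" and two: "card {a \<in> carrier G. a [^] (2::nat) = \<one>} \<le> 2"
  shows "card {a \<in> carrier G. a [^] ((2::nat) ^ j) = \<one>} \<le> 2 ^ j"
proof (induction j)
  case 0
  have "{a \<in> carrier G. a [^] (1::nat) = \<one>} \<subseteq> {\<one>}" by auto
  then show ?case using card_mono[of "{\<one>}"] by fastforce
next
  case (Suc j)
  let ?K = "\<lambda>j. {a \<in> carrier G. a [^] ((2::nat) ^ j) = \<one>}"
  have "card (?K (Suc j)) \<le> 2 * card ((\<lambda>a. a [^] (2::nat)) ` ?K (Suc j))"
  proof (rule card_le_fibres)
    fix b
    have "card {a \<in> ?K (Suc j). a [^] (2::nat) = b} \<le> card {a \<in> carrier G. a [^] (2::nat) = b}"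
      using fin by (intro card_mono) auto
    also have "\<dots> \<le> 2" using card_pow_fibre_le[OF fin, of 2 b] two by simp
    finally show "card {a \<in> ?K (Suc j). a [^] (2::nat) = b} \<le> 2" .
  qed (use fin in auto)
  moreover have "(\<lambda>a. a [^] (2::nat)) ` ?K (Suc j) \<subseteq> ?K j"
    by (auto simp: nat_pow_pow)
  then have "card ((\<lambda>a. a [^] (2::nat)) ` ?K (Suc j)) \<le> card (?K j)"
    using fin by (intro card_mono) auto
  ultimately show ?case using Suc by simp
qed

text \<open>The elements killed by \<open>m\<close> form a subgroup of odd order: an involution in
  it would be killed by both \<open>2\<close> and the odd \<open>m\<close>. Its order divides that
  of the group, hence \<open>m\<close>.\<close>

lemma card_pow_kernel_odd:
  assumes fin: "finite (carrier G)" and ord: "Coset.order G = m * 2 ^ n" and m: "odd m"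
  shows "card {a \<in> carrier G. a [^] m = \<one>} \<le> m"
proof -
  define M where "M = {a \<in> carrier G. a [^] m = \<one>}"
  have M: "subgroup M G"
    by (rule subgroupI) (auto simp: M_def nat_pow_distrib nat_pow_inv intro!: exI[of _ \<one>])
  interpret GM: group "G\<lparr>carrier := M\<rparr>" using M by (rule subgroup_imp_group)
  have finM: "finite M" using fin by (simp add: M_def)
  have "odd (card M)"
  proof
    assume "even (card M)"
    then have "Coset.order (G\<lparr>carrier := M\<rparr>) = 2 ^ 1 * (card M div 2)" by (simp add: Coset.order_def)
    from sylow_thm[OF two_is_prime_nat GM.is_group this] finM
    obtain H where H: "subgroup H (G\<lparr>carrier := M\<rparr>)" "card H = 2" by auto
    interpret GH: group "(G\<lparr>carrier := M\<rparr>)\<lparr>carrier := H\<rparr>" using H(1) by (rule GM.subgroup_imp_group)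
    have "H \<subseteq> {\<one>}"
    proof
      fix h assume h: "h \<in> H"
      then have hM: "h \<in> M" using subgroup.subset[OF H(1)] by auto
      have "h [^]\<^bsub>(G\<lparr>carrier := M\<rparr>)\<lparr>carrier := H\<rparr>\<^esub> Coset.order ((G\<lparr>carrier := M\<rparr>)\<lparr>carrier := H\<rparr>) = \<one>"
        using GH.pow_order_eq_1[of h] h by simp
      then have "h [^] (2::nat) = \<one>"
        using H(2) by (simp add: Coset.order_def nat_pow_def)
      moreover have hm: "h [^] m = \<one>" "h \<in> carrier G" using hM by (auto simp: M_def)
      moreover obtain k where "m = 2 * k + 1" using m oddE by blast
      then have "h [^] m = (h [^] (2::nat)) [^] k \<otimes> h" using hm(2) by (simp add: nat_pow_pow)
      ultimately show "h \<in> {\<one>}" by simp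
    qed
    then have "card H \<le> 1" using card_mono[of "{\<one>}" H] by simp
    with H(2) show False by simp
  qed
  moreover have "card M dvd m * 2 ^ n"
    using lagrange[OF M] ord by (metis dvd_triv_right)
  ultimately have "card M dvd m"
    by (metis coprime_dvd_mult_left_iff coprime_left_2_iff_odd coprime_power_right_iff coprime_commute)
  with m show ?thesis unfolding M_def[symmetric] by (intro dvd_imp_le) (auto intro: Nat.gr0I)
qed

text \<open>By counting, the squares are exactly the elements killed by half the group order.\<close>

lemma nonsquare_pow_half_order:
  assumes fin: "finite (carrier G)" and ord: "Coset.order G = m * 2 ^ Suc n" and m: "odd m"
    and two: "card {a \<in> carrier G. a [^] (2::nat) = \<one>} \<le> 2"
    and x: "x \<in> carrier G" "\<And>y. y \<in> carrier G \<Longrightarrow> x \<noteq> y [^] (2::nat)"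
  shows "x [^] (m * 2 ^ n) \<noteq> \<one>"
proof -
  define S where "S = {a \<in> carrier G. a [^] (m * 2 ^ n) = \<one>}"
  have finS: "finite S" using fin by (simp add: S_def)
  \<comment> \<open>The power \<open>2 ^ n\<close> maps \<open>S\<close> into the elements killed by
    \<open>m\<close>, with fibres of at most \<open>2 ^ n\<close> elements, so \<open>S\<close> has
    at most \<open>2 ^ n * m\<close> elements.\<close>
  have "card S \<le> 2 ^ n * card ((\<lambda>a. a [^] ((2::nat) ^ n)) ` S)"
  proof (rule card_le_fibres[OF finS])
    fix b
    have "card {a \<in> S. a [^] ((2::nat) ^ n) = b} \<le> card {a \<in> carrier G. a [^] ((2::nat) ^ n) = b}"
      using fin by (intro card_mono) (auto simp: S_def)
    also have "\<dots> \<le> 2 ^ n"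
      using card_pow_fibre_le[OF fin, of "2 ^ n" b] card_pow_kernel_two_power[OF fin two, of n] by simp
    finally show "card {a \<in> S. a [^] ((2::nat) ^ n) = b} \<le> 2 ^ n" .
  qed
  moreover have "(\<lambda>a. a [^] ((2::nat) ^ n)) ` S \<subseteq> {a \<in> carrier G. a [^] m = \<one>}"
    by (auto simp: S_def nat_pow_pow mult.commute)
  then have "card ((\<lambda>a. a [^] ((2::nat) ^ n)) ` S) \<le> card {a \<in> carrier G. a [^] m = \<one>}"
    using fin by (intro card_mono) auto
  then have "card ((\<lambda>a. a [^] ((2::nat) ^ n)) ` S) \<le> m"
    using card_pow_kernel_odd[OF fin ord m] by simp
  ultimately have S: "card S \<le> 2 ^ n * m"
    by (meson le_trans mult_le_mono2)
  \<comment> \<open>The squares make up at least half of the group and lie in \<open>S\<close>, so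
    they fill \<open>S\<close>.\<close>
  define H where "H = (\<lambda>a. a [^] (2::nat)) ` carrier G"
  have "card (carrier G) \<le> 2 * card H" unfolding H_def
  proof (rule card_le_fibres[OF fin])
    show "card {a \<in> carrier G. a [^] (2::nat) = b} \<le> 2" for b
      using card_pow_fibre_le[OF fin, of 2 b] two by simp
  qed
  then have "2 ^ n * m \<le> card H" using ord by (simp add: Coset.order_def algebra_simps)
  moreover have "H \<subseteq> S"
  proof
    fix h assume "h \<in> H"
    then obtain g where g: "g \<in> carrier G" "h = g [^] (2::nat)" by (auto simp: H_def)
    then have "h [^] (m * 2 ^ n) = g [^] Coset.order G" by (simp add: nat_pow_pow ord algebra_simps)
    with g show "h \<in> S" by (simp add: S_def pow_order_eq_1)
  qed
  ultimately have "H = S" using S finS by (intro card_seteq) auto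
  moreover have "x \<notin> H" using x by (auto simp: H_def)
  ultimately show ?thesis using x(1) by (auto simp: S_def)
qed

end

section \<open>Reduction of rational points\<close>

definition reduces_to :: "rat \<Rightarrow> 'a::field \<Rightarrow> bool" where
  "reduces_to r u \<longleftrightarrow>
     (\<exists>i j. of_int j \<noteq> (0::'a) \<and> r = of_int i / of_int j \<and> u = of_int i / of_int j)"

lemma reduces_toE:
  assumes "reduces_to r (u :: 'a::field)"
  obtains i j where "of_int j \<noteq> (0::'a)" "r = of_int i / of_int j" "u = of_int i / of_int j"
  using assms unfolding reduces_to_def by (elim exE conjE) (rule that)

lemma reduces_to_of_int: "reduces_to (of_int i) (of_int i)"
  unfolding reduces_to_def by (intro exI[of _ i] exI[of _ 1]) simp

lemma reduces_to_numeral: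
  "reduces_to 0 0" "reduces_to 1 1" "reduces_to (numeral k) (numeral k)"
  using reduces_to_of_int[of 0] reduces_to_of_int[of 1] reduces_to_of_int[of "numeral k"] by simp_all

lemma reduces_to_uminus: "reduces_to r u \<Longrightarrow> reduces_to (- r) (- u)"
  unfolding reduces_to_def by (elim exE conjE) (rule exI[of _ "- _"], rule exI, intro conjI; simp)

lemma reduces_to_add:
  assumes "reduces_to r u" "reduces_to s v"
  shows "reduces_to (r + s) (u + v)"
proof -
  obtain i j where 1: "of_int j \<noteq> (0::'a)" "r = of_int i / of_int j" "u = of_int i / of_int j"
    using assms(1) by (rule reduces_toE)
  obtain k l where 2: "of_int l \<noteq> (0::'a)" "s = of_int k / of_int l" "v = of_int k / of_int l"
    using assms(2) by (rule reduces_toE)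
  from 1 2 have "j \<noteq> 0" "l \<noteq> 0" by auto
  with 1 2 show ?thesis unfolding reduces_to_def
    by (intro exI[of _ "i * l + k * j"] exI[of _ "j * l"]) (simp add: add_frac_eq)
qed

lemma reduces_to_diff: "reduces_to r u \<Longrightarrow> reduces_to s v \<Longrightarrow> reduces_to (r - s) (u - v)"
  using reduces_to_add[of r u "- s" "- v"] by (simp add: reduces_to_uminus)

lemma reduces_to_mult:
  assumes "reduces_to r u" "reduces_to s v"
  shows "reduces_to (r * s) (u * v)"
proof -
  obtain i j where 1: "of_int j \<noteq> (0::'a)" "r = of_int i / of_int j" "u = of_int i / of_int j"
    using assms(1) by (rule reduces_toE)
  obtain k l where 2: "of_int l \<noteq> (0::'a)" "s = of_int k / of_int l" "v = of_int k / of_int l"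
    using assms(2) by (rule reduces_toE)
  from 1 2 show ?thesis unfolding reduces_to_def
    by (intro exI[of _ "i * k"] exI[of _ "j * l"]) simp
qed

lemma reduces_to_power: "reduces_to r u \<Longrightarrow> reduces_to (r ^ n) (u ^ n)"
  by (induction n) (simp_all add: reduces_to_numeral reduces_to_mult)

lemma reduces_to_nonzero: "reduces_to r u \<Longrightarrow> u \<noteq> 0 \<Longrightarrow> r \<noteq> 0"
  unfolding reduces_to_def by auto

lemma reduces_to_divide:
  assumes "reduces_to r u" "reduces_to s v" "v \<noteq> 0"
  shows "reduces_to (r / s) (u / v)"
proof -
  obtain k l where *: "of_int l \<noteq> (0::'a)" "s = of_int k / of_int l" "v = of_int k / of_int l"
    using assms(2) by (rule reduces_toE)
  with assms(3) have "reduces_to (inverse s) (inverse v)" unfolding reduces_to_def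
    by (intro exI[of _ l] exI[of _ k]) auto
  with assms(1) show ?thesis unfolding divide_inverse by (rule reduces_to_mult)
qed

lemmas reduces_to_intros = reduces_to_of_int reduces_to_numeral reduces_to_uminus reduces_to_add
  reduces_to_diff reduces_to_mult reduces_to_power reduces_to_divide

text \<open>The lowest denominator divides every other one, so it is nonzero in the field as soon as
  some denominator is. Hence images are unique and their existence can be read off from
  \<open>quotient_of\<close>.\<close>

lemma reduces_to_quotient_of:
  assumes "reduces_to r u" "quotient_of r = (i, j)"
  shows "of_int j \<noteq> (0::'a)" "u = of_int i / (of_int j :: 'a::field)"
proof -
  obtain k l where *: "of_int l \<noteq> (0::'a)" "r = of_int k / of_int l" "u = of_int k / of_int l"
    using assms(1) by (rule reduces_toE)
  have j: "j > 0" "coprime i j" "r = of_int i / of_int j"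
    using assms(2) quotient_of_denom_pos quotient_of_coprime quotient_of_div by blast+
  have "l \<noteq> 0" using *(1) by auto
  with * j have "of_int (i * l) = (of_int (k * j) :: rat)" by (simp add: field_simps)
  then have e: "i * l = k * j" by (simp only: of_int_eq_iff)
  then have "j dvd i * l" by simp
  with j(2) have "j dvd l" by (simp add: coprime_commute coprime_dvd_mult_right_iff)
  then show j0: "of_int j \<noteq> (0::'a)" using *(1) by (auto elim!: dvdE)
  from e have "of_int i * of_int l = (of_int k * of_int j :: 'a)" by (metis of_int_mult)
  then have "of_int i / of_int j = (of_int k / of_int l :: 'a)"
    using *(1) j0 by (subst frac_eq_eq) simp_all
  with *(3) show "u = of_int i / of_int j" by simp
qed

lemma reduces_to_unique:
  assumes "reduces_to r u" "reduces_to r v"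
  shows "u = v"
proof -
  obtain i j where q: "quotient_of r = (i, j)" by (cases "quotient_of r")
  show ?thesis using reduces_to_quotient_of(2)[OF assms(1) q] reduces_to_quotient_of(2)[OF assms(2) q] by simp
qed

lemma reduces_to_iff:
  assumes "quotient_of r = (i, j)"
  shows "(\<exists>u. reduces_to r (u :: 'a::field)) \<longleftrightarrow> of_int j \<noteq> (0::'a)"
proof
  assume "of_int j \<noteq> (0::'a)"
  then have "reduces_to r (of_int i / of_int j :: 'a)"
    using quotient_of_div[OF assms] unfolding reduces_to_def by (intro exI[of _ i] exI[of _ j]) simp
  then show "\<exists>u. reduces_to r (u :: 'a)" ..
next
  assume "\<exists>u. reduces_to r (u :: 'a)"
  then obtain u :: 'a where "reduces_to r u" ..
  then show "of_int j \<noteq> (0::'a)" using assms by (rule reduces_to_quotient_of)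
qed

text \<open>The lowest denominator vanishes in the field and, by Bezout, the numerator does not, so
  the inverted fraction reduces to zero.\<close>

lemma not_reduces_to_inverse:
  assumes "\<nexists>u::'a::field. reduces_to r u"
  shows "r \<noteq> 0" "reduces_to (1 / r) (0::'a)"
proof -
  obtain i j where q: "quotient_of r = (i, j)" by (cases "quotient_of r")
  have j: "of_int j = (0::'a)" using assms unfolding reduces_to_iff[OF q] by simp
  show "r \<noteq> 0" using assms reduces_to_numeral(1)[where 'a = 'a] by auto
  from q have ij: "j > 0" "coprime i j" "r = of_int i / of_int j"
    using quotient_of_denom_pos quotient_of_coprime quotient_of_div by blast+
  have "of_int i \<noteq> (0::'a)"
  proof
    assume "of_int i = (0::'a)"
    moreover obtain k l where "k * i + l * j = 1" using ij(2) by (metis coprime_iff_gcd_eq_1 bezout_int)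
    then have "of_int k * of_int i + of_int l * of_int j = (1::'a)" by (metis of_int_1 of_int_add of_int_mult)
    ultimately show False using j by simp
  qed
  then show "reduces_to (1 / r) (0::'a)" unfolding reduces_to_def
    using ij j by (intro exI[of _ j] exI[of _ i]) auto
qed

text \<open>If \<open>r\<close> had no image, \<open>1 / r\<close> would reduce to zero, and so
  would \<open>r^2 * (1 / r)^2 = 1\<close>.\<close>

lemma reduces_to_sqrt:
  assumes "reduces_to (r^2) (u :: 'a::field)"
  shows "\<exists>v::'a. reduces_to r v \<and> v^2 = u"
proof (cases "\<exists>v::'a. reduces_to r v")
  case True
  then show ?thesis using reduces_to_power[of r _ 2] reduces_to_unique[OF _ assms] by auto
next
  case False
  from not_reduces_to_inverse[OF False] have "r \<noteq> 0" "reduces_to (1 / r) (0::'a)" by auto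
  then have "reduces_to (r^2 * (1 / r)^2) (u * 0^2)"
    using assms by (intro reduces_to_intros)
  with \<open>r \<noteq> 0\<close> have "reduces_to 1 (0::'a)" by (simp add: power_divide)
  from reduces_to_unique[OF this reduces_to_numeral(2)] show ?thesis by simp
qed

text \<open>On the curve the first coordinate decides between the last two cases: if
  \<open>x\<close> has an image, so has \<open>y^2\<close>, and hence \<open>y\<close> by
  \<open>reduces_to_sqrt\<close>.\<close>

fun ell_reduces_to :: "rat ell_point \<Rightarrow> 'a::field ell_point \<Rightarrow> bool" where
  "ell_reduces_to None P \<longleftrightarrow> P = None"
| "ell_reduces_to (Some (x, y)) None \<longleftrightarrow> (\<nexists>u::'a. reduces_to x u)"
| "ell_reduces_to (Some (x, y)) (Some (u, v)) \<longleftrightarrow> reduces_to x u \<and> reduces_to y v"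

text \<open>For points that are not opposite over the rationals everything depends on the slope. If
  the images are opposite it has no image and the sum goes to infinity; otherwise it can be written
  with a denominator that is nonzero in the field.\<close>

lemma ell_add_reduces_affine:
  fixes t :: int and x y :: rat and u v :: "'a::field"
  defines "a \<equiv> - (of_int (t^2 + 1)) :: rat" and "b \<equiv> - (of_int (t^2 + 1)) :: 'a"
  assumes two: "(2::'a) \<noteq> 0" and on: "on_ell a (x, y)" and xy: "reduces_to x u" "reduces_to y v"
  shows "ell_reduces_to (ell_add a (Some (-1, of_int t)) (Some (x, y)))
           (ell_add b (Some (-1, of_int t)) (Some (u, v)))"
proof (cases "x = -1 \<and> y = - of_int t")
  case True
  then have "reduces_to x (-1::'a)" "reduces_to y (- of_int t :: 'a)"
    by (auto intro: reduces_to_intros)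
  with xy have "u = -1" "v = - of_int t" using reduces_to_unique by blast+
  with True show ?thesis by (simp add: ell_add.simps)
next
  case ne: False
  define l where "l = (if -1 = x then (3 * (-1)^2 + a) / (2 * of_int t) else (y - of_int t) / (x - (-1)))"
  have sum: "ell_add a (Some (-1, of_int t)) (Some (x, y)) =
      Some (l^2 - (-1) - x, l * (-1 - (l^2 - (-1) - x)) - of_int t)"
    using ne by (auto simp: ell_add.simps l_def Let_def)
  have t: "reduces_to (of_int t) (of_int t :: 'a)" and a: "reduces_to a b"
    unfolding a_def b_def by (intro reduces_to_intros)+
  have on1: "y^2 = x^3 + a * x" using on by (simp add: on_ell_def)
  then have on2: "v^2 = u^3 + b * u"
  proof (intro reduces_to_unique)
    show "reduces_to (y^2) (v^2)" by (intro reduces_to_intros xy)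
    show "reduces_to (y^2) (u^3 + b * u)" unfolding on1 by (intro reduces_to_intros xy a)
  qed
  have at: "a = - ((of_int t)^2 + 1)" "b = - ((of_int t)^2 + 1)" by (simp_all add: a_def b_def)
  \<comment> \<open>The curve equations give \<open>y^2 - t^2 = (x + 1) (x^2 - x + 1 + a)\<close>.
    This second form of the slope serves when \<open>x + 1\<close> but not \<open>y + t\<close>
    vanishes in the field.\<close>
  have l1: "l * (y + of_int t) = x^2 - x + 1 + a" if "x \<noteq> -1"
  proof -
    have "(x + 1) * (l * (y + of_int t)) = (y - of_int t) * (y + of_int t)"
      using that by (simp add: l_def field_simps)
    also have "\<dots> = (x + 1) * (x^2 - x + 1 + a)"
      using on1 at(1) by Groebner_Basis.algebra
    finally show ?thesis using that by (simp add: add_eq_0_iff)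
  qed
  have y1: "y = of_int t" if "x = -1"
  proof -
    have "(y - of_int t) * (y + of_int t) = 0" using on1 at(1) that by (simp add: algebra_simps power2_eq_square)
    with ne that show ?thesis by (simp add: eq_neg_iff_add_eq_0)
  qed
  show ?thesis
  proof (cases "u = -1 \<and> v = - of_int t")
    case True
    \<comment> \<open>If the slope had an image, \<open>t = 0\<close> would follow in the field, and
      the numerator \<open>3 + a\<close> or \<open>x^2 - x + 1 + a\<close> would reduce both to
      \<open>2\<close> and to a multiple of a vanishing denominator.\<close>
    have "\<nexists>w::'a. reduces_to l w"
    proof
      assume "\<exists>w::'a. reduces_to l w"
      then obtain w :: 'a where w: "reduces_to l w" by blast
      have "of_int t = (0::'a) \<and> (2::'a) = 0"
      proof (cases "x = -1")
        case x: True
        from y1[OF x] xy t True have "of_int t = - (of_int t :: 'a)"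
          using reduces_to_unique by blast
        then have "2 * (of_int t :: 'a) = 0" by (simp add: eq_neg_iff_add_eq_0)
        with two have t0: "of_int t = (0::'a)" by simp
        have "y \<noteq> - of_int t" using ne x by simp
        with y1[OF x] have "t \<noteq> 0" by auto
        then have "l * (2 * of_int t) = 3 + a" using x by (simp add: l_def)
        moreover have "reduces_to (l * (2 * of_int t)) (w * (2 * of_int t))" "reduces_to (3 + a) (3 + b)"
          by (intro reduces_to_intros w a t)+
        ultimately have "w * (2 * of_int t) = 3 + b" using reduces_to_unique by metis
        with t0 show ?thesis by (simp add: at)
      next
        case x: False
        then have "l * (x + 1) = y - of_int t" by (simp add: l_def add_eq_0_iff)
        moreover have "reduces_to (l * (x + 1)) (w * (u + 1))" "reduces_to (y - of_int t) (v - of_int t)"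
          by (intro reduces_to_intros w xy t)+
        ultimately have "w * (u + 1) = v - of_int t" using reduces_to_unique by metis
        with True have "2 * (of_int t :: 'a) = 0" by simp
        with two have t0: "of_int t = (0::'a)" by simp
        have "reduces_to (l * (y + of_int t)) (w * (v + of_int t))"
          "reduces_to (x^2 - x + 1 + a) (u^2 - u + 1 + b)"
          by (intro reduces_to_intros w xy t a)+
        with l1[OF x] have "w * (v + of_int t) = u^2 - u + 1 + b" using reduces_to_unique by metis
        with True t0 show ?thesis by (simp add: at)
      qed
      with two show False by simp
    qed
    \<comment> \<open>The first coordinate of the sum has an image only if \<open>l^2\<close> has
      one.\<close>
    moreover have "\<exists>w::'a. reduces_to l w" if "reduces_to (l^2 - (-1) - x) (w::'a)" for w
    proof -
      have "reduces_to (l^2 - (-1) - x + x - 1) (w + u - 1)"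
        by (intro reduces_to_intros that xy)
      then show ?thesis using reduces_to_sqrt by fastforce
    qed
    ultimately have "\<nexists>w::'a. reduces_to (l^2 - (-1) - x) w" by blast
    with True show ?thesis unfolding sum by (simp add: ell_add.simps)
  next
    case False
    define k where "k = (if -1 = u then (3 * (-1)^2 + b) / (2 * of_int t) else (v - of_int t) / (u - (-1)))"
    have v1: "v = of_int t \<and> (of_int t :: 'a) \<noteq> 0" if "u = -1"
    proof -
      have "(v - of_int t) * (v + of_int t) = 0" using on2 at(2) that by (simp add: algebra_simps power2_eq_square)
      with False that have "v = of_int t" by (simp add: eq_neg_iff_add_eq_0)
      with False that show ?thesis by auto
    qed
    have lk: "reduces_to l k"
    proof (cases "x = -1")
      case True
      then have u: "u = -1" using xy reduces_to_unique by (metis reduces_to_uminus reduces_to_numeral(2))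
      with v1 two have "2 * of_int t \<noteq> (0::'a)" by simp
      then have "reduces_to ((3 * (-1)^2 + a) / (2 * of_int t)) ((3 * (-1)^2 + b) / (2 * of_int t))"
        by (intro reduces_to_intros a t)
      with True u show ?thesis by (simp add: l_def k_def)
    next
      case x: False
      show ?thesis
      proof (cases "u = -1")
        \<comment> \<open>A chord over the rationals becomes a tangent in the field; the form of the
          slope over \<open>y + t\<close> covers this transition.\<close>
        case u: True
        with v1 two have v: "v + of_int t \<noteq> 0" by simp
        have "reduces_to (y + of_int t) (v + of_int t)" by (intro reduces_to_intros xy t)
        with v have "y + of_int t \<noteq> 0" by (intro reduces_to_nonzero)
        with l1[OF x] have "l = (x^2 - x + 1 + a) / (y + of_int t)" by (simp add: field_simps)
        moreover have "reduces_to ((x^2 - x + 1 + a) / (y + of_int t)) ((u^2 - u + 1 + b) / (v + of_int t))"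
          by (intro reduces_to_intros xy t a v)
        ultimately show ?thesis using u v1 by (simp add: k_def)
      next
        case u: False
        then have "u - (-1) \<noteq> 0" by (simp add: eq_neg_iff_add_eq_0)
        then have "reduces_to ((y - of_int t) / (x - (-1))) ((v - of_int t) / (u - (-1)))"
          by (intro reduces_to_intros xy t)
        with x u show ?thesis by (simp add: l_def k_def)
      qed
    qed
    have "ell_add b (Some (-1, of_int t)) (Some (u, v)) =
        Some (k^2 - (-1) - u, k * (-1 - (k^2 - (-1) - u)) - of_int t)"
      using False by (auto simp: ell_add.simps k_def Let_def)
    moreover have "reduces_to (l^2 - (-1) - x) (k^2 - (-1) - u)"
      "reduces_to (l * (-1 - (l^2 - (-1) - x)) - of_int t) (k * (-1 - (k^2 - (-1) - u)) - of_int t)"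
      by (intro reduces_to_intros lk xy t)+
    ultimately show ?thesis unfolding sum by simp
  qed
qed

text \<open>A point that reduces to infinity is written in the local parameters \<open>1 / x\<close> and \<open>y / x^2\<close>, which
  both reduce to zero.\<close>

lemma ell_add_reduces_infinity:
  fixes t :: int and x y :: rat
  defines "a \<equiv> - (of_int (t^2 + 1)) :: rat"
  assumes on: "on_ell a (x, y)" and x: "\<nexists>u::'a::field. reduces_to x u"
  shows "ell_reduces_to (ell_add a (Some (-1, of_int t)) (Some (x, y))) (Some (-1, of_int t :: 'a))"
proof -
  define T :: rat where "T = of_int t"
  define i where "i = 1 / x"
  define e where "e = y / x^2"
  note [simp] = not_reduces_to_inverse(1)[OF x]
  have i: "reduces_to i (0::'a)" unfolding i_def using not_reduces_to_inverse(2)[OF x] .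
  have T: "reduces_to T (of_int t :: 'a)" unfolding T_def by (rule reduces_to_of_int)
  have aT: "a = - (T^2 + 1)" by (simp add: a_def T_def)
  have a: "reduces_to a (- of_int (t^2 + 1) :: 'a)" unfolding a_def by (intro reduces_to_intros)
  have on1: "y^2 = x^3 + a * x" using on by (simp add: on_ell_def)
  have i0: "i \<noteq> 0" and xi: "x = 1 / i" and ye: "y = e / i^2" by (simp_all add: i_def e_def power_divide)
  have e2: "e^2 = i + a * i^3"
    unfolding e_def i_def power_divide on1 by (simp add: field_simps power2_eq_square power3_eq_cube)
  have "reduces_to (i + a * i^3) (0 + - of_int (t^2 + 1) * 0^3 :: 'a)" by (intro reduces_to_intros i a)
  then have "reduces_to (e^2) (0::'a)" unfolding e2 by simp
  from reduces_to_sqrt[OF this] have e: "reduces_to e (0::'a)" by auto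
  have d: "reduces_to (1 + i) (1 + 0::'a)" by (intro reduces_to_intros i)
  then have i1: "1 + i \<noteq> 0" by (rule reduces_to_nonzero) simp
  have "reduces_to (-1) (-1 :: 'a)" by (intro reduces_to_intros)
  with x have x1: "x \<noteq> -1" by auto
  define l where "l = (y - T) / (x - (-1))"
  have sum: "ell_add a (Some (-1, T)) (Some (x, y)) =
      Some (l^2 - (-1) - x, l * (-1 - (l^2 - (-1) - x)) - T)"
    using x1 by (auto simp: ell_add.simps l_def Let_def)
  have l: "l = (e - T * i^2) / (i * (1 + i))"
  proof -
    have "y - T = (e - T * i^2) / i^2" "x - (-1) = (1 + i) / i"
      unfolding xi ye using i0 by (simp_all add: diff_divide_distrib add_divide_distrib)
    then show ?thesis unfolding l_def using i0 by (simp add: power2_eq_square)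
  qed
  \<comment> \<open>Both \<open>l^2\<close> and \<open>x\<close> have a pole. After multiplication
    by \<open>i^2 (1 + i)^2\<close> the terms linear in \<open>i\<close> cancel by the curve
    equation, so \<open>i^2\<close> divides out and only \<open>1 + i\<close>, which reduces to one,
    is left in the denominator.\<close>
  have x3: "l^2 - (-1) - x = (- 1 - T^2 * i - 2 * T * e + (T^2 + 1) * i^2) / (1 + i)^2"
  proof -
    have "(l^2 - (-1) - x) * (i^2 * (1 + i)^2) = (l * (i * (1 + i)))^2 + (1 - x) * (i^2 * (1 + i)^2)"
      by Groebner_Basis.algebra
    also have "l * (i * (1 + i)) = e - T * i^2" unfolding l using i0 i1 by simp
    also have "(1 - x) * (i^2 * (1 + i)^2) = (i - 1) * i * (1 + i)^2"
      unfolding xi using i0 by (simp add: field_simps power2_eq_square)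
    also have "(e - T * i^2)^2 + (i - 1) * i * (1 + i)^2 =
        i^2 * (- 1 - T^2 * i - 2 * T * e + (T^2 + 1) * i^2)"
      using e2 unfolding aT by Groebner_Basis.algebra
    finally have "(l^2 - (-1) - x) * (1 + i)^2 = - 1 - T^2 * i - 2 * T * e + (T^2 + 1) * i^2"
      using i0 by simp
    then show ?thesis using i1 by (simp add: nonzero_eq_divide_eq)
  qed
  have y3: "l * (-1 - (l^2 - (-1) - x)) = - ((2 - T^2) * e - (2 - T^2) * T * i^2 - 2 * T * (1 + a * i^2)
      + 2 * T^2 * e * i + (T^2 + 2) * e * i - (T^2 + 2) * T * i^3) / (1 + i)^3"
  proof -
    have "(-1 - (l^2 - (-1) - x)) * (1 + i)^2 =
        - ((1 + i)^2) - (- 1 - T^2 * i - 2 * T * e + (T^2 + 1) * i^2)"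
      unfolding x3 using i1 by (simp add: left_diff_distrib)
    also have "\<dots> = - (i * (2 - T^2) - 2 * T * e + (T^2 + 2) * i^2)"
      by Groebner_Basis.algebra
    finally have *: "(-1 - (l^2 - (-1) - x)) * (1 + i)^2 = - (i * (2 - T^2) - 2 * T * e + (T^2 + 2) * i^2)"
      by simp
    have "l * (-1 - (l^2 - (-1) - x)) * (i * (1 + i)^3) =
        (l * (i * (1 + i))) * ((-1 - (l^2 - (-1) - x)) * (1 + i)^2)"
      by (simp add: power2_eq_square power3_eq_cube mult_ac)
    also have "\<dots> = (e - T * i^2) * - (i * (2 - T^2) - 2 * T * e + (T^2 + 2) * i^2)"
      unfolding * using i0 i1 by (simp add: l)
    \<comment> \<open>The only product without a visible factor \<open>i\<close> is the one with
      \<open>e^2\<close>, which the curve equation turns into \<open>i (1 + a i^2)\<close>.\<close>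
    also have "\<dots> = i * - ((2 - T^2) * e - (2 - T^2) * T * i^2 - 2 * T * (1 + a * i^2)
      + 2 * T^2 * e * i + (T^2 + 2) * e * i - (T^2 + 2) * T * i^3)"
      using e2 by Groebner_Basis.algebra
    finally have "l * (-1 - (l^2 - (-1) - x)) * (1 + i)^3 = - ((2 - T^2) * e - (2 - T^2) * T * i^2
      - 2 * T * (1 + a * i^2) + 2 * T^2 * e * i + (T^2 + 2) * e * i - (T^2 + 2) * T * i^3)"
      using i0 by (simp add: mult_ac)
    then show ?thesis using i1 by (simp add: nonzero_eq_divide_eq)
  qed
  have "reduces_to (l^2 - (-1) - x)
     ((- 1 - (of_int t)^2 * 0 - 2 * of_int t * 0 + ((of_int t)^2 + 1) * 0^2) / (1 + 0)^2 :: 'a)"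
    unfolding x3 by (intro reduces_to_intros e i T) simp
  moreover have "reduces_to (l * (-1 - (l^2 - (-1) - x)) - T)
     (- ((2 - (of_int t)^2) * 0 - (2 - (of_int t)^2) * (of_int t) * 0^2
        - 2 * (of_int t) * (1 + (- of_int (t^2 + 1)) * 0^2)
      + 2 * (of_int t)^2 * 0 * 0 + ((of_int t)^2 + 2) * 0 * 0
      - ((of_int t)^2 + 2) * (of_int t) * 0^3) / (1 + 0)^3 - of_int t :: 'a)"
    unfolding y3 by (intro reduces_to_intros e i T a) simp
  ultimately show ?thesis using sum by (simp add: T_def)
qed

section \<open>The sequence over a field\<close>

lemma ec_add_eq_ell_add: "ec_add a P Q = ell_add a P Q"
  by (induction a P Q rule: ec_add.induct) (auto simp: ell_add.simps)

lemma carrier_ell_group [simp]: "carrier (ell_group a) = ell_points a"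
  and mult_ell_group [simp]: "P \<otimes>\<^bsub>ell_group a\<^esub> Q = ell_add a P Q"
  and one_ell_group [simp]: "\<one>\<^bsub>ell_group a\<^esub> = None"
  by (simp_all add: ell_group_def)

lemma ell_base_point: "Some (-1, of_int t) \<in> ell_points (- of_int (t^2 + 1))"
  by (simp add: ell_points_def on_ell_def)

text \<open>\<open>ec_mul\<close> only ever adds the integral base point, so compatibility with that
  addition suffices. Membership in the curve is carried along because the addition lemmas require
  it.\<close>

lemma ec_mul_reduces:
  fixes t :: int
  defines "b \<equiv> - of_int (t^2 + 1) :: 'a::field"
  assumes two: "(2::'a) \<noteq> 0" and b: "b \<noteq> 0"
  shows "ec_mul (- of_int (t^2 + 1)) m (Some (-1, of_int t)) \<in> ell_points (- of_int (t^2 + 1)) \<and>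
    ell_reduces_to (ec_mul (- of_int (t^2 + 1)) m (Some (-1, of_int t)))
      (Some (-1, of_int t) [^]\<^bsub>ell_group b\<^esub> m)"
proof (induction m)
  case (Suc m)
  define R where "R = ec_mul (- of_int (t^2 + 1)) m (Some (-1, of_int t))"
  define S where "S = Some (-1, of_int t) [^]\<^bsub>ell_group b\<^esub> m"
  interpret comm_group "ell_group b" using two b by (rule ell_comm_group)
  have base: "Some (-1, of_int t) \<in> ell_points b" unfolding b_def by (rule ell_base_point)
  have SP: "Some (-1, of_int t) [^]\<^bsub>ell_group b\<^esub> Suc m = ell_add b (Some (-1, of_int t)) S"
    using m_comm[of S "Some (-1, of_int t)"] nat_pow_closed[of "Some (-1, of_int t)" m] base
    by (simp add: S_def)
  have "t^2 + 1 > 0" by (simp add: add_nonneg_pos)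
  then have "t^2 + 1 \<noteq> 0" by linarith
  then have a: "- of_int (t^2 + 1) \<noteq> (0::rat)" by (simp only: neg_equal_0_iff_equal of_int_eq_0_iff not_False_eq_True)
  from Suc have R: "R \<in> ell_points (- of_int (t^2 + 1))" "ell_reduces_to R S"
    by (simp_all add: R_def S_def)
  have "ell_add (- of_int (t^2 + 1)) (Some (-1, of_int t)) R \<in> ell_points (- of_int (t^2 + 1))"
    using R(1) a ell_base_point by (intro ell_add_closed) auto
  moreover have "ell_reduces_to (ell_add (- of_int (t^2 + 1)) (Some (-1, of_int t)) R)
      (ell_add b (Some (-1, of_int t)) S)"
  proof (cases R)
    case None
    with R(2) have "S = None" by simp
    moreover have "reduces_to (-1) (-1::'a)" by (intro reduces_to_intros)
    ultimately show ?thesis using None by (simp add: reduces_to_of_int)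
  next
    case (Some z)
    obtain x y where z: "z = (x, y)" by (cases z)
    from R(1) Some z have on: "on_ell (- of_int (t^2 + 1)) (x, y)" by (auto simp: ell_points_def)
    show ?thesis
    proof (cases S)
      case None
      with R(2) Some z have "\<nexists>u::'a. reduces_to x u" by simp
      from ell_add_reduces_infinity[OF on this] show ?thesis using Some z None by simp
    next
      case (Some w)
      obtain u v where w: "w = (u, v)" by (cases w)
      have "reduces_to x u" "reduces_to y v" using R(2) \<open>R = Some z\<close> Some z w by auto
      from ell_add_reduces_affine[OF two on this] show ?thesis
        using \<open>R = Some z\<close> Some z w by (simp add: b_def)
    qed
  qed
  ultimately show ?case unfolding SP by (simp add: ec_add_eq_ell_add R_def)
qed (simp add: ell_points_def)

section \<open>Modular inverses, and the sequence as doubling on the reduced curve\<close>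

lemma inv_mod_mult:
  assumes "coprime d N" "N > 1"
  shows "[d * inv_mod d N = 1] (mod N)"
proof -
  obtain u where "[d * u = 1] (mod N)" using assms cong_solve_coprime_int by blast
  then have "0 \<le> u mod N \<and> u mod N < N \<and> [d * (u mod N) = 1] (mod N)"
    using assms(2) by (simp add: cong_def mod_mult_right_eq)
  then show ?thesis unfolding inv_mod_def by (rule someI2) blast
qed

lemma of_int_eq_of_cong:
  assumes "[x = y] (mod N)" "of_int N = (0::'a::ring_1)"
  shows "of_int x = (of_int y :: 'a)"
proof -
  obtain k where "x - y = N * k" using assms(1) by (auto simp: cong_iff_dvd_diff elim: dvdE)
  then have "of_int x - of_int y = (0::'a)" using assms(2) by (metis mult_zero_left of_int_diff of_int_mult)
  then show ?thesis by simp
qed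

lemma of_int_inv_mod:
  assumes "coprime d N" "N > 1" "of_int N = (0::'a::field)"
  shows "of_int d \<noteq> (0::'a)" "of_int (inv_mod d N) = (1 / of_int d :: 'a)"
proof -
  have *: "of_int d * of_int (inv_mod d N) = (1::'a)"
    using of_int_eq_of_cong[OF inv_mod_mult[OF assms(1,2)] assms(3)] by simp
  then show "of_int d \<noteq> (0::'a)" by auto
  with * show "of_int (inv_mod d N) = (1 / of_int d :: 'a)" by (simp add: field_simps)
qed

lemma of_int_mod: "of_int N = (0::'a::ring_1) \<Longrightarrow> of_int (x mod N) = (of_int x :: 'a)"
  by (rule of_int_eq_of_cong) auto

text \<open>Coprimality to \<open>N\<close> keeps the denominator nonzero in every field where
  \<open>N\<close> vanishes, so one sequence modulo \<open>N\<close> describes points modulo each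
  prime factor.\<close>

lemma seq_start_imp:
  fixes t :: int
  defines "b \<equiv> - of_int (t^2 + 1) :: 'a::field"
  assumes "(2::'a) \<noteq> 0" "b \<noteq> 0" "of_int N = (0::'a)" "N > 1" "seq_start t m N = Some v"
  shows "\<exists>y. Some (-1, of_int t) [^]\<^bsub>ell_group b\<^esub> m = Some (of_int v, y)"
proof -
  define R where "R = ec_mul (- of_int (t^2 + 1)) m (Some (-1, of_int t))"
  obtain x y \<alpha> \<beta> where R: "R = Some (x, y)" and q: "quotient_of x = (\<alpha>, \<beta>)"
    and c: "coprime \<beta> N" and v: "v = (\<alpha> * inv_mod \<beta> N) mod N"
    using assms(6) unfolding seq_start_def R_def
    by (auto split: option.splits prod.splits if_splits)
  have red: "ell_reduces_to R (Some (-1, of_int t) [^]\<^bsub>ell_group b\<^esub> m)"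
    using ec_mul_reduces[where 'a = 'a, of t m] assms(2,3) by (simp add: R_def b_def)
  note inv = of_int_inv_mod[OF c assms(5,4)]
  have "\<exists>u::'a. reduces_to x u" using reduces_to_iff[OF q] inv(1) by blast
  with red R obtain u w where u: "Some (-1, of_int t) [^]\<^bsub>ell_group b\<^esub> m = Some (u, w)" "reduces_to x u"
    by (cases "Some (-1, of_int t) [^]\<^bsub>ell_group b\<^esub> m") auto
  have "of_int v = (of_int \<alpha> / of_int \<beta> :: 'a)"
    unfolding v by (simp add: of_int_mod[OF assms(4)] inv)
  with reduces_to_quotient_of(2)[OF u(2) q] u(1) show ?thesis by simp
qed

text \<open>The curve equation turns the doubling formula into a square. This yields the step of the
  sequence and shows that first coordinates of doubles are squares.\<close>

lemma ell_double:
  fixes x y b :: "'a::field"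
  assumes "(2::'a) \<noteq> 0" "on_ell b (x, y)" "y \<noteq> 0"
  shows "\<exists>z. ell_add b (Some (x, y)) (Some (x, y)) = Some (((x^2 - b) / (2 * y))^2, z)"
proof -
  have "y^2 = x^3 + b * x" using assms(2) by (simp add: on_ell_def)
  define k where "k = 2 * y"
  have "k \<noteq> 0" using assms by (simp add: k_def)
  have "(3 * x^2 + b)^2 = (x^2 - b)^2 + (x + x) * k^2"
    using \<open>y^2 = _\<close> unfolding k_def by Groebner_Basis.algebra
  then have "((3 * x^2 + b) / k)^2 = ((x^2 - b) / k)^2 + (x + x) * k^2 / k^2"
    unfolding power_divide by (simp only: add_divide_distrib)
  then have "((3 * x^2 + b) / k)^2 - x - x = ((x^2 - b) / k)^2"
    using \<open>k \<noteq> 0\<close> by simp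
  moreover have "y \<noteq> - y" using assms(1,3) by (simp add: eq_neg_iff_add_eq_0 flip: mult_2)
  ultimately show ?thesis by (simp add: ell_add.simps Let_def k_def)
qed

lemma ell_double_zero: "ell_add b (Some (x, 0)) (Some (x, 0)) = None"
  by (simp add: ell_add.simps)

text \<open>In characteristic other than two, the denominator of a step thus vanishes only at points
  of order two.\<close>

lemma of_int_seq_denominator:
  assumes "on_ell (- of_int (t^2 + 1)) (of_int x :: 'a::field, y)"
  shows "of_int (4 * (x^3 - (t^2 + 1) * x)) = (2 * y)^2"
proof -
  have "y^2 = (of_int x)^3 + - ((of_int t)^2 + 1) * of_int x" using assms by (simp add: on_ell_def)
  then have "4 * ((of_int x)^3 - ((of_int t)^2 + 1) * of_int x) = (2 * y)^2" by Groebner_Basis.algebra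
  then show ?thesis by simp
qed

lemma seq_step_imp:
  fixes t :: int
  defines "b \<equiv> - of_int (t^2 + 1) :: 'a::field"
  assumes "(2::'a) \<noteq> 0" "of_int N = (0::'a)" "N > 1" "seq_step t N x = Some v"
    and on: "on_ell b (of_int x, y)"
  shows "\<exists>z. ell_add b (Some (of_int x, y)) (Some (of_int x, y)) = Some (of_int v, z)"
proof -
  define d where "d = 4 * (x^3 - (t^2 + 1) * x)"
  have c: "coprime d N" and v: "v = ((x^2 + t^2 + 1)^2 * inv_mod d N) mod N"
    using assms(5) by (auto simp: seq_step_def Let_def d_def split: if_splits)
  note inv = of_int_inv_mod[OF c assms(4,3)]
  have d: "of_int d = (2 * y)^2" using on unfolding d_def b_def by (rule of_int_seq_denominator)
  with inv(1) have "y \<noteq> 0" by auto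
  from ell_double[OF assms(2) on this]
  obtain z where "ell_add b (Some (of_int x, y)) (Some (of_int x, y)) =
      Some ((((of_int x)^2 - b) / (2 * y))^2, z)" by blast
  moreover have "of_int v = ((((of_int x)^2 - b) / (2 * y))^2 :: 'a)"
    unfolding v by (simp add: of_int_mod[OF assms(3)] inv d power_divide b_def algebra_simps)
  ultimately show ?thesis by simp
qed

lemma seq_x_imp:
  fixes t :: int
  defines "b \<equiv> - of_int (t^2 + 1) :: 'a::field"
  assumes "(2::'a) \<noteq> 0" "b \<noteq> 0" "of_int N = (0::'a)" "N > 1" "seq_x t m N i = Some v"
  shows "\<exists>y. Some (-1, of_int t) [^]\<^bsub>ell_group b\<^esub> (m * 2 ^ i) = Some (of_int v, y)"
  using assms(6)
proof (induction i arbitrary: v)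
  case 0
  then show ?case using seq_start_imp[of t N m v] assms(2-5) by (simp add: b_def)
next
  case (Suc i)
  interpret comm_group "ell_group b" using assms(2,3) by (rule ell_comm_group)
  have base: "Some (-1, of_int t) \<in> carrier (ell_group b)"
    unfolding b_def carrier_ell_group by (rule ell_base_point)
  from Suc.prems obtain w where w: "seq_x t m N i = Some w" "seq_step t N w = Some v"
    by (auto simp: bind_eq_Some_conv)
  with Suc.IH obtain y where y: "Some (-1, of_int t) [^]\<^bsub>ell_group b\<^esub> (m * 2 ^ i) = Some (of_int w, y)"
    by blast
  then have "on_ell b (of_int w, y)"
    using nat_pow_closed[OF base, of "m * 2 ^ i"] by (auto simp: ell_points_def)
  from seq_step_imp[OF assms(2,4,5) w(2) this[unfolded b_def]] obtain z where
    "ell_add b (Some (of_int w, y)) (Some (of_int w, y)) = Some (of_int v, z)" by (auto simp: b_def)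
  moreover have "Some (-1, of_int t) [^]\<^bsub>ell_group b\<^esub> (m * 2 ^ Suc i) =
      ell_add b (Some (of_int w, y)) (Some (of_int w, y))"
    using nat_pow_mult[OF base, of "m * 2 ^ i" "m * 2 ^ i"] y by (simp add: mult_2 distrib_left)
  ultimately show ?case by simp
qed

section \<open>Counting points over finite fields\<close>

lemma card_square_roots_le: "card {y :: 'a::idom. y^2 = v} \<le> 2"
proof (cases "\<exists>z. z^2 = v")
  case True
  then obtain z where "z^2 = v" ..
  then have "{y. y^2 = v} \<subseteq> {z, - z}" by (auto simp: power2_eq_iff)
  then have "card {y. y^2 = v} \<le> card {z, - z}" by (intro card_mono) auto
  then show ?thesis by (simp add: card_insert_if split: if_splits)
next
  case False
  then have e: "{y. y^2 = v} = {}" by auto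
  show ?thesis unfolding e by simp
qed

lemma card_ell_points:
  "card (ell_points (b :: 'a::{field, finite})) = Suc (\<Sum>x\<in>UNIV. card {y. y^2 = x^3 + b * x})"
proof -
  have "{P. on_ell b P} = Sigma UNIV (\<lambda>x. {y. y^2 = x^3 + b * x})"
    by (auto simp: on_ell_def)
  then have "card {P. on_ell b P} = (\<Sum>x\<in>UNIV. card {y. y^2 = x^3 + b * x})" by simp
  then show ?thesis unfolding ell_points_def by (simp add: card_image card_insert_if)
qed

lemma card_ell_points_le: "card (ell_points (b :: 'a::{field, finite})) \<le> 2 * CARD('a) + 1"
proof -
  have "(\<Sum>x\<in>UNIV. card {y. y^2 = x^3 + b * x}) \<le> of_nat CARD('a) * 2"
    by (rule sum_bounded_above) (rule card_square_roots_le)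
  then show ?thesis by (simp add: card_ell_points)
qed

lemma finite_ell_points [simp]: "finite (ell_points (b :: 'a::{field, finite}))"
  by (simp add: ell_points_def)

text \<open>The last value makes \<open>2 ^ (n - 1)\<close> times \<open>R\<close> equal to
  \<open>(0, 0)\<close>, a point of order two. So \<open>R\<close> has order exactly
  \<open>2 ^ n\<close>, which the number of points bounds.\<close>

lemma seq_x_zero_imp_le_card:
  fixes t :: int
  assumes "(2::'a::{field, finite}) \<noteq> 0" "of_int (t^2 + 1) \<noteq> (0::'a)" "of_int N = (0::'a)" "N > 1"
    and "n > 0" "seq_x t m N (n - 1) = Some 0"
  shows "2 ^ n \<le> 2 * CARD('a) + 1"
proof -
  define b :: 'a where "b = - of_int (t^2 + 1)"
  have b: "b \<noteq> 0" using assms(2) unfolding b_def neg_equal_0_iff_equal .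
  interpret comm_group "ell_group b" using assms(1) b by (rule ell_comm_group)
  define R where "R = Some (-1, of_int t) [^]\<^bsub>ell_group b\<^esub> m"
  have base: "Some (-1, of_int t) \<in> carrier (ell_group b)"
    unfolding b_def carrier_ell_group by (rule ell_base_point)
  then have R: "R \<in> carrier (ell_group b)" unfolding R_def by (rule nat_pow_closed)
  obtain y where y: "R [^]\<^bsub>ell_group b\<^esub> ((2::nat) ^ (n - 1)) = Some (0, y)"
    using seq_x_imp[OF assms(1) _ assms(3,4,6)] b nat_pow_pow[OF base] by (auto simp: b_def R_def)
  then have "y = 0" using nat_pow_closed[OF R, of "2 ^ (n - 1)"] by (auto simp: ell_points_def on_ell_def)
  have "R [^]\<^bsub>ell_group b\<^esub> ((2::nat) ^ n) = R [^]\<^bsub>ell_group b\<^esub> ((2::nat) ^ (n - 1) + 2 ^ (n - 1))"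
    using assms(5) by (cases n) (simp_all add: mult_2)
  also have "\<dots> = None"
    using nat_pow_mult[OF R, of "2 ^ (n - 1)" "2 ^ (n - 1)"] y \<open>y = 0\<close> by (simp add: ell_double_zero)
  finally have "ord R dvd 2 ^ n" using pow_eq_id[OF R] by simp
  moreover have "\<not> ord R dvd 2 ^ (n - 1)" using pow_eq_id[OF R, of "2 ^ (n - 1)"] y by simp
  ultimately have "ord R = 2 ^ n"
    using assms(5) divides_primepow_nat[OF two_is_prime_nat, of "ord R" n]
    by (metis Suc_pred' le_SucE le_imp_power_dvd)
  moreover have "ord R \<le> Coset.order (ell_group b)" using R by (intro ord_le_group_order) auto
  ultimately show ?thesis using card_ell_points_le[of b] by (simp add: Coset.order_def)
qed

section \<open>Supersingular reduction\<close>

text \<open>Averaging over the fibres of \<open>y \<mapsto> y^2\<close> avoids the theory of quadratic residues: each summand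
  is at most two, and the total is \<open>2 CARD('a)\<close>.\<close>

lemma card_square_roots_add_uminus:
  assumes two: "(2::'a::{field, finite}) \<noteq> 0" and m1: "\<And>z::'a. z^2 \<noteq> -1"
  shows "card {y :: 'a. y^2 = v} + card {y. y^2 = - v} = 2"
proof -
  let ?f = "\<lambda>v::'a. card {y. y^2 = v} + card {y. y^2 = - v}"
  have le: "?f v \<le> 2" for v
  proof (cases "{y. y^2 = v} = {} \<or> {y. y^2 = - v} = {}")
    case True
    then show ?thesis using card_square_roots_le[of v] card_square_roots_le[of "- v"]
      by (metis add.left_neutral add.right_neutral card.empty)
  next
    case False
    then obtain y z where yz: "y^2 = v" "z^2 = - v" by blast
    have "v = 0"
    proof (rule ccontr)
      assume "v \<noteq> 0"
      with yz have "(z / y)^2 = -1" by (auto simp: power_divide)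
      with m1 show False by blast
    qed
    then show ?thesis by (simp add: numeral_2_eq_2)
  qed
  have total: "(\<Sum>v::'a\<in>UNIV. card {y. y^2 = v}) = CARD('a)"
  proof -
    have "(\<Sum>v::'a\<in>UNIV. card {y. y^2 = v}) = card (\<Union>v::'a. {y. y^2 = v})"
      by (rule card_UN_disjoint[symmetric]) auto
    also have "(\<Union>v::'a. {y. y^2 = v}) = UNIV" by auto
    finally show ?thesis .
  qed
  also have "(\<Sum>v::'a\<in>UNIV. card {y. y^2 = v}) = (\<Sum>v::'a\<in>UNIV. card {y. y^2 = - v})"
    by (rule sum.reindex_bij_witness[of _ uminus uminus]) auto
  finally have "sum ?f UNIV = (\<Sum>v::'a\<in>UNIV. 2)" using total by (simp add: sum.distrib)
  then show ?thesis using sum_mono_inv[of ?f "UNIV :: 'a set" "\<lambda>_. 2" v] le by simp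
qed

text \<open>The cubic is an odd function, so the contributions of \<open>x\<close> and
  \<open>- x\<close> add up to two, which is one point per abscissa on average; infinity is the
  extra point.\<close>

lemma card_ell_points_supersingular:
  fixes b :: "'a::{field, finite}"
  assumes "(2::'a) \<noteq> 0" and "\<And>z::'a. z^2 \<noteq> -1"
  shows "card (ell_points b) = CARD('a) + 1"
proof -
  let ?g = "\<lambda>x::'a. card {y. y^2 = x^3 + b * x}"
  have "(\<Sum>x\<in>UNIV. ?g x) = (\<Sum>x\<in>UNIV. ?g (- x))"
    by (rule sum.reindex_bij_witness[of _ uminus uminus]) auto
  then have "2 * (\<Sum>x\<in>UNIV. ?g x) = (\<Sum>x\<in>UNIV. ?g x + ?g (- x))" by (simp add: sum.distrib)
  also have "\<dots> = (\<Sum>x::'a\<in>UNIV. 2)"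
  proof (rule sum.cong[OF refl])
    fix x :: 'a
    have "(- x)^3 + b * (- x) = - (x^3 + b * x)" by simp
    then show "?g x + ?g (- x) = 2"
      using card_square_roots_add_uminus[OF assms, of "x^3 + b * x"] by metis
  qed
  finally show ?thesis by (simp add: card_ell_points)
qed

lemma seq_start_defined:
  fixes t :: int
  defines "b \<equiv> - of_int (t^2 + 1) :: 'a::field"
  assumes "(2::'a) \<noteq> 0" "b \<noteq> 0" "prime (int CHAR('a))"
    and "Some (-1, of_int t) [^]\<^bsub>ell_group b\<^esub> m \<noteq> None"
  shows "seq_start t m (int CHAR('a)) \<noteq> None"
proof -
  define R where "R = ec_mul (- of_int (t^2 + 1)) m (Some (-1, of_int t))"
  have red: "ell_reduces_to R (Some (-1, of_int t) [^]\<^bsub>ell_group b\<^esub> m)"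
    using ec_mul_reduces[where 'a = 'a, of t m] assms(2,3) by (simp add: R_def b_def)
  with assms(5) obtain x y where R: "R = Some (x, y)" by (cases R) auto
  obtain \<alpha> \<beta> where q: "quotient_of x = (\<alpha>, \<beta>)" by (cases "quotient_of x")
  from red R assms(5) obtain u :: 'a where "reduces_to x u" by auto
  then have "of_int \<beta> \<noteq> (0::'a)" using q by (rule reduces_to_quotient_of)
  then have "\<not> int CHAR('a) dvd \<beta>" by (simp add: of_int_eq_0_iff_char_dvd)
  then have "coprime \<beta> (int CHAR('a))" using assms(4) prime_imp_coprime coprime_commute by blast
  then show ?thesis using R q by (simp add: seq_start_def R_def)
qed

lemma seq_step_defined:
  fixes t :: int
  defines "b \<equiv> - of_int (t^2 + 1) :: 'a::field"
  assumes "(2::'a) \<noteq> 0" "prime (int CHAR('a))" "on_ell b (of_int x, y)" "y \<noteq> 0"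
  shows "seq_step t (int CHAR('a)) x \<noteq> None"
proof -
  define d where "d = 4 * (x^3 - (t^2 + 1) * x)"
  have d: "of_int d = (2 * y)^2" using assms(4) unfolding d_def b_def by (rule of_int_seq_denominator)
  have "2 * y \<noteq> 0" using assms(2,5) by simp
  then have "of_int d \<noteq> (0::'a)" unfolding d by (rule power_not_zero)
  then have "\<not> int CHAR('a) dvd d" by (simp add: of_int_eq_0_iff_char_dvd)
  then have "coprime d (int CHAR('a))" using assms(3) prime_imp_coprime coprime_commute by blast
  then show ?thesis by (simp add: seq_step_def d_def Let_def)
qed

lemma seq_x_bounds: "N > 0 \<Longrightarrow> seq_x t m N i = Some v \<Longrightarrow> 0 \<le> v \<and> v < N"
  by (cases i) (auto simp: seq_start_def seq_step_def Let_def bind_eq_Some_conv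
      split: option.splits prod.splits if_splits)

lemma seq_x_prime_char:
  fixes t :: int
  defines "b \<equiv> - of_int (t^2 + 1) :: 'a::{field, finite}"
  assumes two: "(2::'a) \<noteq> 0" and p: "prime (int CHAR('a))" and card: "CARD('a) + 1 = m * 2 ^ n"
    and m: "odd m" and n: "n > 1"
    and m1: "\<And>z::'a. z^2 \<noteq> -1" and nsq: "\<And>z::'a. z^2 \<noteq> - b"
  shows "seq_x t m (int CHAR('a)) (n - 1) = Some 0"
proof -
  define p where "p = int CHAR('a)"
  have p0: "of_int p = (0::'a)" "p > 1" using prime_gt_1_int[OF p] by (simp_all add: p_def)
  have b: "b \<noteq> 0" using nsq[of 0] by auto
  interpret comm_group "ell_group b" using two b by (rule ell_comm_group)
  define P where "P = Some (-1 :: 'a, of_int t :: 'a)"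
  have P: "P \<in> carrier (ell_group b)" unfolding P_def b_def carrier_ell_group by (rule ell_base_point)
  have ord: "Coset.order (ell_group b) = m * 2 ^ n"
    using card card_ell_points_supersingular[OF two m1, of b] by (simp add: Coset.order_def)
  have sq: "Q [^]\<^bsub>ell_group b\<^esub> (2::nat) = ell_add b Q Q" if "Q \<in> ell_points b" for Q
    using that by (simp add: numeral_2_eq_2)
  \<comment> \<open>The factor \<open>x^2 + b\<close> has no root because \<open>- b\<close> is not
    a square.\<close>
  have y0: "x = 0" if "on_ell b (x, 0)" for x
  proof -
    from that have "x * (x^2 + b) = 0" by (simp add: on_ell_def algebra_simps power2_eq_square power3_eq_cube)
    with nsq[of x] show ?thesis by (simp add: eq_neg_iff_add_eq_0)
  qed
  have double: "\<exists>x y. Q = Some (x, y) \<and> y \<noteq> 0" if "Q \<in> ell_points b" "ell_add b Q Q \<noteq> None" for Q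
    using that ell_double_zero[of b] by (cases Q) auto
  have "{Q \<in> carrier (ell_group b). Q [^]\<^bsub>ell_group b\<^esub> (2::nat) = \<one>\<^bsub>ell_group b\<^esub>} \<subseteq> {None, Some (0, 0)}"
  proof
    fix Q assume "Q \<in> {Q \<in> carrier (ell_group b). Q [^]\<^bsub>ell_group b\<^esub> (2::nat) = \<one>\<^bsub>ell_group b\<^esub>}"
    then have Q: "Q \<in> ell_points b" "ell_add b Q Q = None" using sq by auto
    show "Q \<in> {None, Some (0, 0)}"
    proof (cases Q)
      case (Some z)
      obtain x y where z: "z = (x, y)" by (cases z)
      have on: "on_ell b (x, y)" using Q Some z by (auto simp: ell_points_def)
      with ell_double[OF two on] Q(2) Some z have "y = 0" by auto
      with y0 on Some z show ?thesis by simp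
    qed simp
  qed
  then have "card {Q \<in> carrier (ell_group b). Q [^]\<^bsub>ell_group b\<^esub> (2::nat) = \<one>\<^bsub>ell_group b\<^esub>}
      \<le> card {None, Some (0::'a, 0::'a)}"
    by (intro card_mono) auto
  then have tors: "card {Q \<in> carrier (ell_group b). Q [^]\<^bsub>ell_group b\<^esub> (2::nat) = \<one>\<^bsub>ell_group b\<^esub>} \<le> 2" by simp
  \<comment> \<open>The first coordinate of a double is a square, whereas that of \<open>P\<close>
    is \<open>-1\<close>.\<close>
  have "P \<noteq> Q [^]\<^bsub>ell_group b\<^esub> (2::nat)" if Q: "Q \<in> carrier (ell_group b)" for Q
  proof
    assume *: "P = Q [^]\<^bsub>ell_group b\<^esub> (2::nat)"
    with Q sq have PQ: "ell_add b Q Q = P" by simp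
    with Q double[of Q] obtain x y where xy: "Q = Some (x, y)" "y \<noteq> 0" by (auto simp: P_def)
    with Q have "on_ell b (x, y)" by (auto simp: ell_points_def)
    from ell_double[OF two this xy(2)] PQ xy(1) have "((x^2 - b) / (2 * y))^2 = -1" by (auto simp: P_def)
    with m1 show False by blast
  qed
  then have half: "P [^]\<^bsub>ell_group b\<^esub> (m * 2 ^ (n - 1)) \<noteq> \<one>\<^bsub>ell_group b\<^esub>"
    using ord n m tors P by (intro nonsquare_pow_half_order) auto
  \<comment> \<open>An earlier multiple at infinity would send all further doublings to infinity,
    contrary to \<open>half\<close>.\<close>
  have ne: "P [^]\<^bsub>ell_group b\<^esub> (m * 2 ^ i) \<noteq> None" if "i \<le> n - 1" for i
  proof
    assume *: "P [^]\<^bsub>ell_group b\<^esub> (m * 2 ^ i) = None"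
    have "(2::nat) ^ (n - 1) = 2 ^ i * 2 ^ (n - 1 - i)"
      using that by (metis le_add_diff_inverse power_add)
    then have e: "m * 2 ^ (n - 1) = m * 2 ^ i * 2 ^ (n - 1 - i)" by simp
    have "P [^]\<^bsub>ell_group b\<^esub> (m * 2 ^ (n - 1)) = \<one>\<^bsub>ell_group b\<^esub>"
      unfolding e using * nat_pow_pow[OF P, of "m * 2 ^ i" "2 ^ (n - 1 - i)"] nat_pow_one by simp
    with half show False by contradiction
  qed
  have pow_Suc: "P [^]\<^bsub>ell_group b\<^esub> (m * 2 ^ Suc i) =
      ell_add b (P [^]\<^bsub>ell_group b\<^esub> (m * 2 ^ i)) (P [^]\<^bsub>ell_group b\<^esub> (m * 2 ^ i))" for i
    using nat_pow_mult[OF P, of "m * 2 ^ i" "m * 2 ^ i"] by (simp add: mult_2 distrib_left)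
  have "seq_x t m p i \<noteq> None" if "i \<le> n - 1" for i
    using that
  proof (induction i)
    case 0
    then show ?case using seq_start_defined[where 'a = 'a, of t m] two b p ne[of 0]
      by (simp add: b_def p_def P_def)
  next
    case (Suc i)
    then obtain v where v: "seq_x t m p i = Some v" by auto
    then obtain y where y: "P [^]\<^bsub>ell_group b\<^esub> (m * 2 ^ i) = Some (of_int v, y)"
      using seq_x_imp[OF two, of t p m i v] b p0 by (auto simp: b_def P_def)
    with nat_pow_closed[OF P, of "m * 2 ^ i"] have on: "on_ell b (of_int v, y)" by (auto simp: ell_points_def)
    \<comment> \<open>The next multiple is not infinity, so this point does not have order two and
      the next denominator is invertible.\<close>
    have "y \<noteq> 0" using ne[OF Suc.prems] y unfolding pow_Suc by (auto simp: ell_double_zero)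
    with seq_step_defined[OF two p, of t v y] on v show ?case by (simp add: b_def p_def)
  qed
  then obtain v where v: "seq_x t m p (n - 1) = Some v" by auto
  then obtain y where y: "P [^]\<^bsub>ell_group b\<^esub> (m * 2 ^ (n - 1)) = Some (of_int v, y)"
    using seq_x_imp[OF two, of t p m "n - 1" v] b p0 by (auto simp: b_def P_def)
  with nat_pow_closed[OF P, of "m * 2 ^ (n - 1)"] have on: "on_ell b (of_int v, y)"
    by (auto simp: ell_points_def)
  \<comment> \<open>One more doubling gives the multiple by the group order.\<close>
  have "ell_add b (Some (of_int v, y)) (Some (of_int v, y)) = None"
    using pow_Suc[of "n - 1"] pow_order_eq_1[OF P] n y ord by simp
  with ell_double[OF two on] have "y = 0" by auto
  with y0 on have "of_int v = (0::'a)" by simp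
  then have "p dvd v" by (simp add: p_def of_int_eq_0_iff_char_dvd)
  moreover have "0 \<le> v \<and> v < p" using v p0 by (intro seq_x_bounds) auto
  ultimately have "v = 0" by (metis mod_pos_pos_trivial dvd_imp_mod_0)
  with v show ?thesis by (simp add: p_def)
qed

section \<open>The criterion\<close>

lemma QuadRes_of_square_mod_ring:
  assumes "(z :: 'p::prime_card mod_ring)^2 = of_int d"
  shows "QuadRes (int CARD('p)) d"
proof -
  obtain c where "z = of_nat c" using surj_of_nat_mod_ring[of z] by blast
  with assms have "of_int ((int c)^2) = (of_int d :: 'p mod_ring)" by simp
  then have "[(int c)^2 = d] (mod (int CARD('p)))"
    by (simp only: of_int_eq_iff_cong_CHAR semiring_char_mod_ring)
  then show ?thesis unfolding QuadRes_def by blast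
qed

text \<open>Euler's criterion with the odd exponent \<open>(p - 1) div 2\<close>.\<close>

lemma not_QuadRes_minus_one:
  assumes "prime p" "p mod 4 = 3"
  shows "\<not> QuadRes (int p) (-1)"
proof
  assume *: "QuadRes (int p) (-1)"
  have "p > 2" using assms(2) prime_gt_1_nat[OF assms(1)] by (cases "p = 2") auto
  have "\<not> int p dvd -1" using \<open>p > 2\<close> by auto
  then have "Legendre (-1) (int p) = 1" using * by (simp add: Legendre_def cong_0_iff)
  moreover have "odd ((p - 1) div 2)" using assms(2) by presburger
  ultimately have "[1 = -1] (mod (int p))"
    using euler_criterion[OF assms(1) \<open>p > 2\<close>, of "-1"] by simp
  then have "int p dvd 2" by (simp add: cong_iff_dvd_diff)
  with \<open>p > 2\<close> show False by (auto dest: zdvd_imp_le)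
qed

text \<open>What both directions need about one prime, phrased without the field, so that it makes
  sense for a variable \<open>p\<close> and not just for the cardinality of a type.\<close>

definition seq_criterion :: "nat \<Rightarrow> bool" where
  "seq_criterion p \<longleftrightarrow>
     (\<forall>t m n. p + 1 = m * 2 ^ n \<longrightarrow> odd m \<longrightarrow> n > 1 \<longrightarrow> \<not> QuadRes (int p) (t^2 + 1) \<longrightarrow>
        seq_x t m (int p) (n - 1) = Some 0) \<and>
     (\<forall>t m n N. int p dvd N \<longrightarrow> N > 1 \<longrightarrow> n > 0 \<longrightarrow> \<not> int p dvd t^2 + 1 \<longrightarrow>
        seq_x t m N (n - 1) = Some 0 \<longrightarrow> 2 ^ n \<le> 2 * p + 1)"

lemma seq_criterion_CARD:
  assumes "odd CARD('p::prime_card)"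
  shows "seq_criterion CARD('p)"
proof -
  have two: "(2 :: 'p mod_ring) \<noteq> 0"
  proof
    assume "(2 :: 'p mod_ring) = 0"
    then have "of_int 2 = (0 :: 'p mod_ring)" by simp
    then have "int CARD('p) dvd 2" unfolding of_int_eq_0_iff_char_dvd by simp
    then have "int CARD('p) \<le> 2" by (rule zdvd_imp_le) simp
    with assms prime_gt_1_nat[OF prime_card[where 'a = 'p]] show False
      by (cases "CARD('p) = 2") auto
  qed
  have char: "int CHAR('p mod_ring) = int CARD('p)" by simp
  have p: "prime (int CHAR('p mod_ring))" unfolding char using prime_card[where 'a = 'p] by simp
  have "seq_x t m (int CARD('p)) (n - 1) = Some 0"
    if *: "CARD('p) + 1 = m * 2 ^ n" "odd m" "n > 1" "\<not> QuadRes (int CARD('p)) (t^2 + 1)" for t m n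
  proof -
    obtain k where "n = Suc (Suc k)" using *(3) by (metis One_nat_def less_imp_Suc_add add_Suc)
    with *(1) have "CARD('p) + 1 = 4 * (m * 2 ^ k)" by simp
    then have "CARD('p) mod 4 = 3" by presburger
    from not_QuadRes_minus_one[OF prime_card this]
    have m1: "z^2 \<noteq> -1" for z :: "'p mod_ring"
      using QuadRes_of_square_mod_ring[of z "-1"] by auto
    have nsq: "z^2 \<noteq> - (- of_int (t^2 + 1))" for z :: "'p mod_ring"
      using QuadRes_of_square_mod_ring[of z "t^2 + 1"] *(4) unfolding minus_minus by blast
    show ?thesis using seq_x_prime_char[OF two p _ *(2,3) m1 nsq] *(1) by simp
  qed
  moreover have "2 ^ n \<le> 2 * CARD('p) + 1"
    if "int CARD('p) dvd N" "N > 1" "n > 0" "\<not> int CARD('p) dvd t^2 + 1" "seq_x t m N (n - 1) = Some 0"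
    for t m n N
  proof -
    have "of_int (t^2 + 1) \<noteq> (0 :: 'p mod_ring)" "of_int N = (0 :: 'p mod_ring)"
      unfolding of_int_eq_0_iff_char_dvd using that by simp_all
    from seq_x_zero_imp_le_card[OF two this that(2,3,5)] show ?thesis by simp
  qed
  ultimately show ?thesis unfolding seq_criterion_def by blast
qed

text \<open>A type cannot depend on the prime \<open>p\<close>, so \<open>seq_criterion_CARD\<close> is not directly applicable to a
  variable \<open>p\<close>. Instead we define a single type whose cardinality is a counterexample to
  \<open>seq_criterion\<close> if there is one.\<close>

definition critical_prime :: nat where
  "critical_prime =
     (if \<exists>p. prime p \<and> odd p \<and> \<not> seq_criterion p
      then SOME p. prime p \<and> odd p \<and> \<not> seq_criterion p else 3)"

lemma prime_critical_prime: "prime critical_prime \<and> odd critical_prime"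
proof (cases "\<exists>p. prime p \<and> odd p \<and> \<not> seq_criterion p")
  case True
  from someI_ex[OF this] True show ?thesis unfolding critical_prime_def by auto
next
  case False
  \<comment> \<open>The default \<open>3\<close> keeps \<open>critical_prime\<close> an odd prime
    when there is no counterexample.\<close>
  then have e: "critical_prime = 3" unfolding critical_prime_def by (rule if_not_P)
  show ?thesis unfolding e by simp
qed

typedef critical_index = "{0..<critical_prime}"
  using prime_critical_prime prime_gt_0_nat by (intro exI[of _ 0]) auto

lemma CARD_critical_index: "CARD(critical_index) = critical_prime"
  using type_definition.card[OF type_definition_critical_index] by simp

instance critical_index :: prime_card
  by intro_classes (simp add: CARD_critical_index prime_critical_prime)

lemma seq_criterion:
  assumes "prime p" "odd p"
  shows "seq_criterion p"
proof (rule ccontr)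
  assume "\<not> seq_criterion p"
  with assms have ex: "\<exists>p. prime p \<and> odd p \<and> \<not> seq_criterion p" by blast
  from someI_ex[OF this] ex have "\<not> seq_criterion critical_prime" unfolding critical_prime_def by auto
  with seq_criterion_CARD[where 'p = critical_index] prime_critical_prime show False
    unfolding CARD_critical_index by blast
qed

lemma seq_x_defined_mono: "seq_x t m N j \<noteq> None \<Longrightarrow> i \<le> j \<Longrightarrow> seq_x t m N i \<noteq> None"
  by (induction j) (auto simp: le_Suc_eq bind_eq_Some_conv)

lemma Jacobi_prime: "prime p \<Longrightarrow> Jacobi a p = Legendre a p"
  using multiplicity_prime[OF prime_imp_prime_elem, of p] by (simp add: Jacobi_def prime_prime_factors)

text \<open>A common prime factor contributes a vanishing Legendre symbol. By contraposition, the
  symbol \<open>-1\<close> keeps \<open>t^2 + 1\<close> nonzero, and hence the curve nonsingular,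
  modulo each prime factor of \<open>A\<close>.\<close>

lemma Jacobi_zero:
  assumes "prime p" "p dvd n" "n \<noteq> 0" "p dvd a"
  shows "Jacobi a n = 0"
proof -
  have "p \<in> prime_factors n" using assms by (simp add: prime_factors_dvd)
  moreover have "Legendre a p = 0" using assms by (simp add: Legendre_def cong_0_iff)
  moreover have "multiplicity p n > 0" using prime_multiplicity_gt_zero_iff[OF prime_imp_prime_elem[OF assms(1)] assms(3)] assms(2) by blast
  ultimately show ?thesis unfolding Jacobi_def by (intro prod_zero) (auto intro!: bexI[of _ p])
qed

text \<open>The smaller of a prime factor and its cofactor has square at most \<open>n\<close>; if
  it is the cofactor, any prime factor of the cofactor will do.\<close>

lemma composite_small_prime_factor:
  assumes "(n::nat) > 1" "\<not> prime n"
  obtains q where "prime q" "q dvd n" "q * q \<le> n"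
proof -
  obtain p d where p: "prime p" "n = p * d"
    using assms(1) prime_factor_nat[of n] by (auto elim: dvdE)
  show ?thesis
  proof (cases "p \<le> d")
    case True
    with p show ?thesis by (intro that[of p]) auto
  next
    case False
    have "d \<noteq> 1" using p assms(2) by auto
    then obtain q where q: "prime q" "q dvd d" using prime_factor_nat by blast
    have "d > 0" using p assms(1) by (cases d) auto
    with q have "q \<le> d" by (intro dvd_imp_le)
    with False have "q * q \<le> p * d" by (intro mult_le_mono) auto
    with p q show ?thesis by (intro that[of q]) auto
  qed
qed

theorem theorem3:
  fixes m n :: nat and t :: int
  defines "A \<equiv> int m * 2 ^ n - 1"
  assumes "m \<ge> 1" and "odd m" and "n > 1"
    and "\<not> 3 dvd A" and "\<not> 5 dvd A"
    and "4 * m < 2 ^ n"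
    and "Jacobi (t^2 + 1) A = -1"
  shows "prime A \<longleftrightarrow>
           ((\<forall>i \<le> n - 1. seq_x t m A i \<noteq> None) \<and> seq_x t m A (n - 1) = Some 0)"
proof -
  define a where "a = m * 2 ^ n - 1"
  have "m * 2 ^ n \<ge> 1 * 2 ^ 2" using assms(2,4) by (intro mult_le_mono power_increasing) auto
  then have a: "a > 1" "a + 1 = m * 2 ^ n" by (simp_all add: a_def)
  from a(2) have "int (a + 1) = int (m * 2 ^ n)" by (rule arg_cong)
  then have A: "A = int a" by (simp add: A_def)
  have "even (a + 1)" unfolding a(2) using assms(4) by simp
  then have odd: "odd a" by simp
  show ?thesis
  proof
    assume "prime A"
    then have "prime a" using A by simp
    moreover have "\<not> QuadRes (int a) (t^2 + 1)"
      using assms(8) Jacobi_prime[OF \<open>prime A\<close>] by (auto simp: A Legendre_def split: if_splits)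
    ultimately have "seq_x t m A (n - 1) = Some 0"
      using seq_criterion[of a] odd a A assms(3,4) unfolding seq_criterion_def by blast
    then show "(\<forall>i \<le> n - 1. seq_x t m A i \<noteq> None) \<and> seq_x t m A (n - 1) = Some 0"
      using seq_x_defined_mono[of t m A "n - 1"] by auto
  next
    assume *: "(\<forall>i \<le> n - 1. seq_x t m A i \<noteq> None) \<and> seq_x t m A (n - 1) = Some 0"
    show "prime A"
    proof (rule ccontr)
      assume "\<not> prime A"
      then have "\<not> prime a" using A by simp
      with a(1) obtain q where q: "prime q" "q dvd a" "q * q \<le> a"
        by (rule composite_small_prime_factor)
      have "\<not> int q dvd t^2 + 1" using Jacobi_zero[of "int q" A "t^2 + 1"] q a A assms(8) by auto
      moreover have oddq: "odd q" using q(2) odd by (meson dvd_trans)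
      have "int q dvd A" "A > 1" "n > 0" "seq_x t m A (n - 1) = Some 0"
        using q(2) a(1) A assms(4) * by simp_all
      ultimately have "2 ^ n \<le> 2 * q + 1"
        by (intro seq_criterion[OF q(1) oddq, unfolded seq_criterion_def, THEN conjunct2, rule_format])
      moreover have "even ((2::nat) ^ n)" using assms(4) by simp
      \<comment> \<open>An even number below the odd bound \<open>2 * q + 1\<close> is at most
        \<open>2 * q\<close>.\<close>
      ultimately have le: "2 ^ n \<le> 2 * q" by presburger
      \<comment> \<open>From \<open>q * q \<le> a < m * 2 ^ n\<close> and
        \<open>4 * m < 2 ^ n\<close> the square of \<open>2 * q\<close> is less than that of
        \<open>2 ^ n\<close>, against \<open>le\<close>.\<close>
      have "(2 * q) * (2 * q) < 4 * (m * 2 ^ n)" using q(3) a(2) by simp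
      also have "\<dots> \<le> 2 ^ n * 2 ^ n" using assms(7) by simp
      also have "\<dots> \<le> (2 * q) * (2 * q)" using le by (intro mult_le_mono)
      finally show False by simp
    qed
  qed
qed

end
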